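(* Let $\mathcal{T}$ be a triangulated category with a metric $\{B_n\}_{n\in\mathbb{N}}$ and let $\{C_n\}_{n\in\mathbb{N}}$ be its improvement. Let $\mathfrak{S}_B(\mathcal{T})$ denote the completion of $\mathcal{T}$ with respect to $\{B_n\}_{n\in\mathbb{N}}$ and $\mathfrak{S}_C(\mathcal{T})$ the completion of $\mathcal{T}$ with respect to $\{C_n\}_{n\in\mathbb{N}}$. Then $\mathfrak{S}_B(\mathcal{T})$ is a triangulated subcategory of $\mathfrak{S}_C(\mathcal{T})$.
   Context: $\mathbb{N}=\{1,2,\dots\}$. All subcategories are full. Let $\mathcal{T}$ be a triangulated category with shift $\Sigma$. For subcategories $\mathcal{X},\mathcal{Z}\subseteq\mathcal{T}$, $\mathcal{X}*\mathcal{Z}$ is the subcategory of all objects $T$ admitting a distinguished triangle $X\to T\to Z\to\Sigma X$ with $X\in\mathcal{X}$, $Z\in\mathcal{Z}$. A metric on $\mathcal{T}$ is a non-increasing chain $B_1\supseteq B_2\supseteq\cdots$ of subcategories of $\mathcal{T}$ with $B_n*B_n=B_n$ and $0\in B_n$ for all $n$. A sequence $E_*=(E_1\to E_2\to\cdots)$ in $\mathcal{T}$ is a good Cauchy sequence if for all $i\in\mathbb{N}$, $j\in\mathbb{Z}$ there is $M\in\mathbb{N}$ such that for all $m'\ge m\ge M$ the cone $D_{m,m'}$ of the composite map $E_m\to E_{m'}$ satisfies $\Sigma^jD_{m,m'}\in B_i$. The improvement of a metric $\{B_n\}$ is the sequence $\{C_n\}$ defined by $C_1:=B_1$ and $C_n:=B_n\cap\Sigma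 C_{n-1}\cap\Sigma^{-1}C_{n-1}$ for $n>1$; it is a metric on $\mathcal{T}$. $\mathrm{Mod}\text{-}\mathcal{T}$ is the category of additive contravariant functors $\mathcal{T}\to\mathrm{Ab}$ and $Y:\mathcal{T}\to\mathrm{Mod}\text{-}\mathcal{T}$ is the Yoneda embedding. With respect to a given metric $\{B_n\}$: $\mathfrak{C}(\mathcal{T})=\bigcap_{j\in\mathbb{Z}}\bigcup_{i\in\mathbb{N}}Y(\Sigma^jB_i)^\perp$, where $\mathcal{C}^\perp$ is the subcategory of objects $X$ with $\mathrm{Hom}(C,X)=0$ for all $C\in\mathcal{C}$; $\mathfrak{L}(\mathcal{T})$ is the subcategory of $\mathrm{Mod}\text{-}\mathcal{T}$ of functors isomorphic to $\varinjlim Y(E_* )$ for some good Cauchy sequence $E_*$ in $\mathcal{T}$; and the completion is $\mathfrak{S}(\mathcal{T})=\mathfrak{C}(\mathcal{T})\cap\mathfrak{L}(\mathcal{T})$. By a theorem of Neeman, $\mathfrak{S}(\mathcal{T})$ is triangulated with shift $\Sigma E:=E\circ\Sigma^{-1}$ and with distinguished triangles those sequences $A\to B\to C\to\Sigma A$ in $\mathfrak{S}(\mathcal{T})$ isomorphic to the directed colimit in $\mathrm{Mod}\text{-}\mathcal{T}$ of the Yoneda image of a directed ($\mathbb{N}$-indexed) diagram of distinguished triangles $a_*\to b_*\to c_*\to\Sigma a_*$ in $\mathcal{T}$ in which $a_*,b_*,c_*,\Sigma a_*$ are good Cauchy sequences. *)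

theory Defs
  imports "HOL-Algebra.Group" "HOL-Library.FuncSet"
begin

section \<open>Additive categories\<close>

record ('o, 'a) cat_data =
  Obj :: "'o set"
  Arr :: "'a set"
  Dom :: "'a \<Rightarrow> 'o"
  Cod :: "'a \<Rightarrow> 'o"
  Id :: "'o \<Rightarrow> 'a"
  Comp :: "'a \<Rightarrow> 'a \<Rightarrow> 'a"  (infixl "\<cdot>\<index>" 70)

definition homs :: "('o, 'a, 'z) cat_data_scheme \<Rightarrow> 'o \<Rightarrow> 'o \<Rightarrow> 'a set" where
  "homs T x y = {f \<in> Arr T. Dom T f = x \<and> Cod T f = y}"

locale category =
  fixes T :: "('o, 'a, 'z) cat_data_scheme" (structure)
  assumes Dom_closed: "f \<in> Arr T \<Longrightarrow> Dom T f \<in> Obj T"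
    and Cod_closed: "f \<in> Arr T \<Longrightarrow> Cod T f \<in> Obj T"
    and Id_closed: "x \<in> Obj T \<Longrightarrow> Id T x \<in> homs T x x"
    and Comp_closed: "f \<in> homs T x y \<Longrightarrow> g \<in> homs T y z \<Longrightarrow> g \<cdot> f \<in> homs T x z"
    and Comp_assoc: "f \<in> homs T w x \<Longrightarrow> g \<in> homs T x y \<Longrightarrow> h \<in> homs T y z \<Longrightarrow>
      (h \<cdot> g) \<cdot> f = h \<cdot> (g \<cdot> f)"
    and Id_left: "f \<in> homs T x y \<Longrightarrow> Id T y \<cdot> f = f"
    and Id_right: "f \<in> homs T x y \<Longrightarrow> f \<cdot> Id T x = f"

definition isos :: "('o, 'a, 'z) cat_data_scheme \<Rightarrow> 'o \<Rightarrow> 'o \<Rightarrow> 'a set" where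
  "isos T x y = {f \<in> homs T x y. \<exists>g \<in> homs T y x.
     g \<cdot>\<^bsub>T\<^esub> f = Id T x \<and> f \<cdot>\<^bsub>T\<^esub> g = Id T y}"

definition zero_object :: "('o, 'a, 'z) cat_data_scheme \<Rightarrow> 'o \<Rightarrow> bool" where
  "zero_object T z \<longleftrightarrow> z \<in> Obj T \<and>
     (\<forall>x \<in> Obj T. (\<exists>!f. f \<in> homs T z x) \<and> (\<exists>!f. f \<in> homs T x z))"

record ('o, 'a) preadd_data = "('o, 'a) cat_data" +
  Add :: "'a \<Rightarrow> 'a \<Rightarrow> 'a"  (infixl "\<boxplus>\<index>" 65)
  Zero :: "'o \<Rightarrow> 'o \<Rightarrow> 'a"

definition hom_group :: "('o, 'a, 'z) preadd_data_scheme \<Rightarrow> 'o \<Rightarrow> 'o \<Rightarrow> 'a monoid" where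
  "hom_group T x y = \<lparr>carrier = homs T x y, mult = Add T, one = Zero T x y\<rparr>"

definition neg :: "('o, 'a, 'z) preadd_data_scheme \<Rightarrow> 'a \<Rightarrow> 'a" where
  "neg T f = inv\<^bsub>hom_group T (Dom T f) (Cod T f)\<^esub> f"

definition biproduct :: "('o, 'a, 'z) preadd_data_scheme \<Rightarrow> 'o \<Rightarrow> 'o \<Rightarrow> 'o \<Rightarrow> bool" where
  "biproduct T x y p \<longleftrightarrow> p \<in> Obj T \<and>
     (\<exists>i \<in> homs T x p. \<exists>j \<in> homs T y p. \<exists>q \<in> homs T p x. \<exists>r \<in> homs T p y.
        q \<cdot>\<^bsub>T\<^esub> i = Id T x \<and> r \<cdot>\<^bsub>T\<^esub> j = Id T y \<and>
        q \<cdot>\<^bsub>T\<^esub> j = Zero T y x \<and> r \<cdot>\<^bsub>T\<^esub> i = Zero T x y \<and>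
        (i \<cdot>\<^bsub>T\<^esub> q) \<boxplus>\<^bsub>T\<^esub> (j \<cdot>\<^bsub>T\<^esub> r) = Id T p)"

locale additive_category = category T
  for T :: "('o, 'a, 'z) preadd_data_scheme" (structure) +
  assumes hom_comm_group: "x \<in> Obj T \<Longrightarrow> y \<in> Obj T \<Longrightarrow> comm_group (hom_group T x y)"
    and Comp_Add_right: "f \<in> homs T x y \<Longrightarrow> f' \<in> homs T x y \<Longrightarrow> g \<in> homs T y z \<Longrightarrow>
      g \<cdot> (f \<boxplus> f') = (g \<cdot> f) \<boxplus> (g \<cdot> f')"
    and Comp_Add_left: "f \<in> homs T x y \<Longrightarrow> g \<in> homs T y z \<Longrightarrow> g' \<in> homs T y z \<Longrightarrow>
      (g \<boxplus> g') \<cdot> f = (g \<cdot> f) \<boxplus> (g' \<cdot> f)"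
    and ex_zero_object: "\<exists>z. zero_object T z"
    and ex_biproduct: "x \<in> Obj T \<Longrightarrow> y \<in> Obj T \<Longrightarrow> \<exists>p. biproduct T x y p"


section \<open>Triangulated categories\<close>

text \<open>A triangle \<open>X \<rightarrow> Y \<rightarrow> Z \<rightarrow> \<Sigma>X\<close> is the triple of its arrows.\<close>

record ('o, 'a) tri_data = "('o, 'a) preadd_data" +
  ShO :: "'o \<Rightarrow> 'o"
  ShA :: "'a \<Rightarrow> 'a"
  Tri :: "('a \<times> 'a \<times> 'a) set"

text \<open>As the notation \<open>\<Sigma>\<^sup>j\<close> for integers \<open>j\<close> and the formula \<open>\<Sigma>E = E \<circ> \<Sigma>\<inverse>\<close> presuppose, the
  shift is an automorphism of the category.\<close>

locale triangulated_category = additive_category T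
  for T :: "('o, 'a, 'z) tri_data_scheme" (structure) +
  assumes ShO_bij: "bij_betw (ShO T) (Obj T) (Obj T)"
    and ShA_bij: "bij_betw (ShA T) (Arr T) (Arr T)"
    and ShA_closed: "f \<in> homs T x y \<Longrightarrow> ShA T f \<in> homs T (ShO T x) (ShO T y)"
    and ShA_Id: "x \<in> Obj T \<Longrightarrow> ShA T (Id T x) = Id T (ShO T x)"
    and ShA_Comp: "f \<in> homs T x y \<Longrightarrow> g \<in> homs T y z \<Longrightarrow> ShA T (g \<cdot> f) = ShA T g \<cdot> ShA T f"
    and ShA_Add: "f \<in> homs T x y \<Longrightarrow> g \<in> homs T x y \<Longrightarrow> ShA T (f \<boxplus> g) = ShA T f \<boxplus> ShA T g"
    and Tri_closed: "(f, g, h) \<in> Tri T \<Longrightarrow>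
      \<exists>x y z. f \<in> homs T x y \<and> g \<in> homs T y z \<and> h \<in> homs T z (ShO T x)"
    and Tri_iso: "(f, g, h) \<in> Tri T \<Longrightarrow>
      f \<in> homs T x y \<Longrightarrow> g \<in> homs T y z \<Longrightarrow> h \<in> homs T z (ShO T x) \<Longrightarrow>
      f' \<in> homs T x' y' \<Longrightarrow> g' \<in> homs T y' z' \<Longrightarrow> h' \<in> homs T z' (ShO T x') \<Longrightarrow>
      a \<in> isos T x x' \<Longrightarrow> b \<in> isos T y y' \<Longrightarrow> c \<in> isos T z z' \<Longrightarrow>
      f' \<cdot> a = b \<cdot> f \<Longrightarrow> g' \<cdot> b = c \<cdot> g \<Longrightarrow> h' \<cdot> c = ShA T a \<cdot> h \<Longrightarrow>
      (f', g', h') \<in> Tri T"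
    and TR1_Id: "x \<in> Obj T \<Longrightarrow> zero_object T z \<Longrightarrow> (Id T x, Zero T x z, Zero T z (ShO T x)) \<in> Tri T"
    and TR1_cone: "f \<in> Arr T \<Longrightarrow> \<exists>g h. (f, g, h) \<in> Tri T"
    and TR2: "f \<in> homs T x y \<Longrightarrow> g \<in> homs T y z \<Longrightarrow> h \<in> homs T z (ShO T x) \<Longrightarrow>
      (f, g, h) \<in> Tri T \<longleftrightarrow> (g, h, neg T (ShA T f)) \<in> Tri T"
    and TR3: "(f, g, h) \<in> Tri T \<Longrightarrow> (f', g', h') \<in> Tri T \<Longrightarrow>
      a \<in> homs T (Dom T f) (Dom T f') \<Longrightarrow> b \<in> homs T (Cod T f) (Cod T f') \<Longrightarrow> f' \<cdot> a = b \<cdot> f \<Longrightarrow>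
      \<exists>c \<in> homs T (Cod T g) (Cod T g'). g' \<cdot> b = c \<cdot> g \<and> h' \<cdot> c = ShA T a \<cdot> h"
    and TR4: "f \<in> homs T x y \<Longrightarrow> g \<in> homs T y z \<Longrightarrow>
      (f, u, u') \<in> Tri T \<Longrightarrow> (g, v, v') \<in> Tri T \<Longrightarrow> (g \<cdot> f, w, w') \<in> Tri T \<Longrightarrow>
      \<exists>a \<in> homs T (Cod T u) (Cod T w). \<exists>b \<in> homs T (Cod T w) (Cod T v).
        (a, b, ShA T u \<cdot> v') \<in> Tri T \<and>
        a \<cdot> u = w \<cdot> g \<and> w' \<cdot> a = u' \<and> b \<cdot> w = v \<and> v' \<cdot> b = ShA T f \<cdot> w'"

text \<open>A full, replete, additive subcategory stable under \<open>\<Sigma>\<close> and \<open>\<Sigma>\<inverse>\<close>, having the two-out-of-three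
  property for the distinguished triangles of the ambient category, and whose own structure
  (composition, addition, shift, distinguished triangles) is the restriction of the ambient one.\<close>

definition triangulated_subcategory ::
    "('o, 'a, 'y) tri_data_scheme \<Rightarrow> ('o, 'a, 'z) tri_data_scheme \<Rightarrow> bool" where
  "triangulated_subcategory D T \<longleftrightarrow>
     Obj D \<subseteq> Obj T \<and>
     (\<forall>x \<in> Obj D. \<forall>y \<in> Obj D. homs D x y = homs T x y) \<and>
     Arr D = (\<Union>x \<in> Obj D. \<Union>y \<in> Obj D. homs T x y) \<and>
     (\<forall>x \<in> Obj D. Id D x = Id T x) \<and>
     (\<forall>x \<in> Obj D. \<forall>y \<in> Obj D. \<forall>z \<in> Obj D. \<forall>f \<in> homs T x y. \<forall>g \<in> homs T y z.
        g \<cdot>\<^bsub>D\<^esub> f = g \<cdot>\<^bsub>T\<^esub> f) \<and>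
     (\<forall>x \<in> Obj D. \<forall>y \<in> Obj D. Zero D x y = Zero T x y) \<and>
     (\<forall>x \<in> Obj D. \<forall>y \<in> Obj D. \<forall>f \<in> homs T x y. \<forall>g \<in> homs T x y.
        f \<boxplus>\<^bsub>D\<^esub> g = f \<boxplus>\<^bsub>T\<^esub> g) \<and>
     (\<forall>x \<in> Obj D. \<forall>y \<in> Obj T. isos T x y \<noteq> {} \<longrightarrow> y \<in> Obj D) \<and>
     (\<exists>z \<in> Obj D. zero_object T z) \<and>
     (\<forall>x \<in> Obj D. \<forall>y \<in> Obj D. \<forall>p. biproduct T x y p \<longrightarrow> p \<in> Obj D) \<and>
     (\<forall>x \<in> Obj D. ShO D x = ShO T x) \<and>
     (\<forall>f \<in> Arr D. ShA D f = ShA T f) \<and>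
     ShO T ` Obj D = Obj D \<and>
     (\<forall>(f, g, h) \<in> Tri T.
        (Dom T f \<in> Obj D \<and> Cod T f \<in> Obj D \<longrightarrow> Cod T g \<in> Obj D) \<and>
        (Cod T f \<in> Obj D \<and> Cod T g \<in> Obj D \<longrightarrow> Dom T f \<in> Obj D) \<and>
        (Dom T f \<in> Obj D \<and> Cod T g \<in> Obj D \<longrightarrow> Cod T f \<in> Obj D)) \<and>
     Tri D = {(f, g, h) \<in> Tri T. f \<in> Arr D \<and> g \<in> Arr D \<and> h \<in> Arr D}"

definition ShO_inv :: "('o, 'a, 'z) tri_data_scheme \<Rightarrow> 'o \<Rightarrow> 'o" where
  "ShO_inv T = inv_into (Obj T) (ShO T)"

definition ShA_inv :: "('o, 'a, 'z) tri_data_scheme \<Rightarrow> 'a \<Rightarrow> 'a" where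
  "ShA_inv T = inv_into (Arr T) (ShA T)"

definition shift_pow :: "('o, 'a, 'z) tri_data_scheme \<Rightarrow> int \<Rightarrow> 'o \<Rightarrow> 'o" where
  "shift_pow T j = (if j \<ge> 0 then ShO T ^^ nat j else ShO_inv T ^^ nat (- j))"


section \<open>Metrics and good Cauchy sequences\<close>

text \<open>Full subcategories of \<open>T\<close> are given by their sets of objects.\<close>

definition star :: "('o, 'a, 'z) tri_data_scheme \<Rightarrow> 'o set \<Rightarrow> 'o set \<Rightarrow> 'o set" where
  "star T X Z = {t. \<exists>f g h. (f, g, h) \<in> Tri T \<and> Dom T f \<in> X \<and> Cod T f = t \<and> Cod T g \<in> Z}"

text \<open>The index set \<open>{1, 2, \<dots>}\<close> of metrics and sequences is renumbered as \<open>{0, 1, \<dots>}\<close>: what is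
  usually written \<open>B\<^sub>n\<close> is \<open>B (n - 1)\<close> here.\<close>

definition metric :: "('o, 'a, 'z) tri_data_scheme \<Rightarrow> (nat \<Rightarrow> 'o set) \<Rightarrow> bool" where
  "metric T B \<longleftrightarrow> (\<forall>n. B n \<subseteq> Obj T \<and> B (Suc n) \<subseteq> B n \<and> star T (B n) (B n) = B n \<and>
     (\<exists>z \<in> B n. zero_object T z))"

primrec improvement ::
    "('o, 'a, 'z) tri_data_scheme \<Rightarrow> (nat \<Rightarrow> 'o set) \<Rightarrow> nat \<Rightarrow> 'o set" where
  "improvement T B 0 = B 0"
| "improvement T B (Suc n) =
     B (Suc n) \<inter> ShO T ` improvement T B n \<inter> ShO_inv T ` improvement T B n"

text \<open>A sequence \<open>E\<^sub>0 \<rightarrow> E\<^sub>1 \<rightarrow> \<dots>\<close> is given by its arrows \<open>e n\<close>, so that \<open>E\<^sub>n\<close> is \<open>Dom T (e n)\<close>.\<close>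

definition sequence :: "('o, 'a, 'z) cat_data_scheme \<Rightarrow> (nat \<Rightarrow> 'a) \<Rightarrow> bool" where
  "sequence T e \<longleftrightarrow> (\<forall>n. e n \<in> homs T (Dom T (e n)) (Dom T (e (Suc n))))"

primrec steps :: "('o, 'a, 'z) cat_data_scheme \<Rightarrow> (nat \<Rightarrow> 'a) \<Rightarrow> nat \<Rightarrow> nat \<Rightarrow> 'a" where
  "steps T e m 0 = Id T (Dom T (e m))"
| "steps T e m (Suc k) = e (m + k) \<cdot>\<^bsub>T\<^esub> steps T e m k"

text \<open>The composite \<open>E\<^sub>m \<rightarrow> E\<^sub>n\<close> for \<open>m \<le> n\<close>.\<close>

definition trans_map :: "('o, 'a, 'z) cat_data_scheme \<Rightarrow> (nat \<Rightarrow> 'a) \<Rightarrow> nat \<Rightarrow> nat \<Rightarrow> 'a" where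
  "trans_map T e m n = steps T e m (n - m)"

definition is_cone :: "('o, 'a, 'z) tri_data_scheme \<Rightarrow> 'a \<Rightarrow> 'o \<Rightarrow> bool" where
  "is_cone T f d \<longleftrightarrow> (\<exists>g h. (f, g, h) \<in> Tri T \<and> Cod T g = d)"

text \<open>Cones exist and are unique up to isomorphism, and the members of a metric are replete, so it
  is immaterial whether all cones or some cone are required to lie in \<open>B i\<close>.\<close>

definition good_Cauchy ::
    "('o, 'a, 'z) tri_data_scheme \<Rightarrow> (nat \<Rightarrow> 'o set) \<Rightarrow> (nat \<Rightarrow> 'a) \<Rightarrow> bool" where
  "good_Cauchy T B e \<longleftrightarrow> sequence T e \<and>
     (\<forall>i. \<forall>j :: int. \<exists>M. \<forall>m m'. M \<le> m \<and> m \<le> m' \<longrightarrow>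
        (\<forall>d. is_cone T (trans_map T e m m') d \<longrightarrow> shift_pow T j d \<in> B i))"


section \<open>The category of modules\<close>

text \<open>Additive functors \<open>T\<^sup>o\<^sup>p \<rightarrow> Ab\<close>, where \<open>Ab\<close> consists of the abelian groups with elements in a
  type \<open>'m\<close>, which plays the role of the universe.  For example, \<open>'m = (nat \<times> 'a) set\<close> is large
  enough to contain, up to isomorphism, the values of all representable functors and of all
  their sequential colimits.  All functions are extensional, so that functors and natural transformations
  agreeing on \<open>T\<close> are equal.\<close>

record ('o, 'a, 'm) presheaf =
  Grp :: "'o \<Rightarrow> 'm monoid"
  Act :: "'a \<Rightarrow> 'm \<Rightarrow> 'm"

definition modules :: "('o, 'a, 'z) preadd_data_scheme \<Rightarrow> ('o, 'a, 'm) presheaf set" where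
  "modules T = {F.
     Grp F \<in> extensional (Obj T) \<and> Act F \<in> extensional (Arr T) \<and>
     (\<forall>x \<in> Obj T. comm_group (Grp F x)) \<and>
     (\<forall>f \<in> Arr T. Act F f \<in> hom (Grp F (Cod T f)) (Grp F (Dom T f)) \<inter>
        extensional (carrier (Grp F (Cod T f)))) \<and>
     (\<forall>x \<in> Obj T. \<forall>s \<in> carrier (Grp F x). Act F (Id T x) s = s) \<and>
     (\<forall>x y z. \<forall>f \<in> homs T x y. \<forall>g \<in> homs T y z. \<forall>s \<in> carrier (Grp F z).
        Act F (g \<cdot>\<^bsub>T\<^esub> f) s = Act F f (Act F g s)) \<and>
     (\<forall>x y. \<forall>f \<in> homs T x y. \<forall>g \<in> homs T x y. \<forall>s \<in> carrier (Grp F y).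
        Act F (f \<boxplus>\<^bsub>T\<^esub> g) s = Act F f s \<otimes>\<^bsub>Grp F x\<^esub> Act F g s)}"

text \<open>The two functors may take values in groups over different types; this allows comparing
  modules over \<open>'m\<close> with representable functors and with colimits of such.\<close>

definition nat_trans :: "('o, 'a, 'z) cat_data_scheme \<Rightarrow>
    ('o, 'a, 'm) presheaf \<Rightarrow> ('o, 'a, 'n) presheaf \<Rightarrow> ('o \<Rightarrow> 'm \<Rightarrow> 'n) set" where
  "nat_trans T F G = {\<eta> \<in> extensional (Obj T).
     (\<forall>x \<in> Obj T. \<eta> x \<in> hom (Grp F x) (Grp G x) \<inter> extensional (carrier (Grp F x))) \<and>
     (\<forall>x y. \<forall>f \<in> homs T x y. \<forall>s \<in> carrier (Grp F y).
        \<eta> x (Act F f s) = Act G f (\<eta> y s))}"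

definition nt_id :: "('o, 'a, 'z) cat_data_scheme \<Rightarrow> ('o, 'a, 'm) presheaf \<Rightarrow> 'o \<Rightarrow> 'm \<Rightarrow> 'm" where
  "nt_id T F = (\<lambda>x \<in> Obj T. \<lambda>s \<in> carrier (Grp F x). s)"

text \<open>The composite of \<open>\<eta>\<close>, with source \<open>F\<close>, followed by \<open>\<theta>\<close>.\<close>

definition nt_comp :: "('o, 'a, 'z) cat_data_scheme \<Rightarrow> ('o, 'a, 'm) presheaf \<Rightarrow>
    ('o \<Rightarrow> 'n \<Rightarrow> 'k) \<Rightarrow> ('o \<Rightarrow> 'm \<Rightarrow> 'n) \<Rightarrow> 'o \<Rightarrow> 'm \<Rightarrow> 'k" where
  "nt_comp T F \<theta> \<eta> = (\<lambda>x \<in> Obj T. \<lambda>s \<in> carrier (Grp F x). \<theta> x (\<eta> x s))"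

definition nt_zero :: "('o, 'a, 'z) cat_data_scheme \<Rightarrow>
    ('o, 'a, 'm) presheaf \<Rightarrow> ('o, 'a, 'n) presheaf \<Rightarrow> 'o \<Rightarrow> 'm \<Rightarrow> 'n" where
  "nt_zero T F G = (\<lambda>x \<in> Obj T. \<lambda>s \<in> carrier (Grp F x). \<one>\<^bsub>Grp G x\<^esub>)"

definition nt_add :: "('o, 'a, 'z) cat_data_scheme \<Rightarrow>
    ('o, 'a, 'm) presheaf \<Rightarrow> ('o, 'a, 'n) presheaf \<Rightarrow>
    ('o \<Rightarrow> 'm \<Rightarrow> 'n) \<Rightarrow> ('o \<Rightarrow> 'm \<Rightarrow> 'n) \<Rightarrow> 'o \<Rightarrow> 'm \<Rightarrow> 'n" where
  "nt_add T F G \<eta> \<theta> = (\<lambda>x \<in> Obj T. \<lambda>s \<in> carrier (Grp F x). \<eta> x s \<otimes>\<^bsub>Grp G x\<^esub> \<theta> x s)"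

definition nat_isos :: "('o, 'a, 'z) cat_data_scheme \<Rightarrow>
    ('o, 'a, 'm) presheaf \<Rightarrow> ('o, 'a, 'n) presheaf \<Rightarrow> ('o \<Rightarrow> 'm \<Rightarrow> 'n) set" where
  "nat_isos T F G = {\<eta> \<in> nat_trans T F G. \<exists>\<theta> \<in> nat_trans T G F.
     nt_comp T F \<theta> \<eta> = nt_id T F \<and> nt_comp T G \<eta> \<theta> = nt_id T G}"

type_synonym ('o, 'a, 'm) presheaf_map =
  "('o, 'a, 'm) presheaf \<times> ('o \<Rightarrow> 'm \<Rightarrow> 'm) \<times> ('o, 'a, 'm) presheaf"

definition Mod :: "('o, 'a, 'z) preadd_data_scheme \<Rightarrow>
    (('o, 'a, 'm) presheaf, ('o, 'a, 'm) presheaf_map) preadd_data" where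
  "Mod T = \<lparr>
     Obj = modules T,
     Arr = {(F, \<eta>, G). F \<in> modules T \<and> G \<in> modules T \<and> \<eta> \<in> nat_trans T F G},
     Dom = (\<lambda>(F, \<eta>, G). F),
     Cod = (\<lambda>(F, \<eta>, G). G),
     Id = (\<lambda>F. (F, nt_id T F, F)),
     Comp = (\<lambda>(G, \<theta>, H) (F, \<eta>, G'). (F, nt_comp T F \<theta> \<eta>, H)),
     Add = (\<lambda>(F, \<eta>, G) (F', \<theta>, G'). (F, nt_add T F G \<eta> \<theta>, G)),
     Zero = (\<lambda>F G. (F, nt_zero T F G, G))\<rparr>"

definition yoneda :: "('o, 'a, 'z) preadd_data_scheme \<Rightarrow> 'o \<Rightarrow> ('o, 'a, 'a) presheaf" where
  "yoneda T c = \<lparr>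
     Grp = (\<lambda>x \<in> Obj T. hom_group T x c),
     Act = (\<lambda>f \<in> Arr T. \<lambda>g \<in> homs T (Cod T f) c. g \<cdot>\<^bsub>T\<^esub> f)\<rparr>"

definition right_perp :: "('o, 'a, 'z) preadd_data_scheme \<Rightarrow>
    ('o, 'a, 'n) presheaf set \<Rightarrow> ('o, 'a, 'm) presheaf set" where
  "right_perp T \<C> = {F \<in> modules T. \<forall>G \<in> \<C>. nat_trans T G F = {nt_zero T G F}}"

definition shift_mod :: "('o, 'a, 'z) tri_data_scheme \<Rightarrow>
    ('o, 'a, 'm) presheaf \<Rightarrow> ('o, 'a, 'm) presheaf" where
  "shift_mod T F = \<lparr>
     Grp = (\<lambda>x \<in> Obj T. Grp F (ShO_inv T x)),
     Act = (\<lambda>f \<in> Arr T. Act F (ShA_inv T f))\<rparr>"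

definition shift_nt :: "('o, 'a, 'z) tri_data_scheme \<Rightarrow>
    ('o \<Rightarrow> 'm \<Rightarrow> 'n) \<Rightarrow> 'o \<Rightarrow> 'm \<Rightarrow> 'n" where
  "shift_nt T \<eta> = (\<lambda>x \<in> Obj T. \<eta> (ShO_inv T x))"


section \<open>Directed colimits of representable functors\<close>

text \<open>Directed colimits in the category of modules are formed objectwise.  At \<open>x\<close>, the colimit
  of \<open>Y(e)\<close> is the quotient of the disjoint union of the groups \<open>Hom(x, E\<^sub>n)\<close> by the relation of
  becoming equal at a later stage.\<close>

definition colim_rel :: "('o, 'a, 'z) cat_data_scheme \<Rightarrow> (nat \<Rightarrow> 'a) \<Rightarrow> 'o \<Rightarrow>
    ((nat \<times> 'a) \<times> (nat \<times> 'a)) set" where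
  "colim_rel T e x = {((m, f), (n, g)). f \<in> homs T x (Dom T (e m)) \<and> g \<in> homs T x (Dom T (e n)) \<and>
     (\<exists>k. m \<le> k \<and> n \<le> k \<and> trans_map T e m k \<cdot>\<^bsub>T\<^esub> f = trans_map T e n k \<cdot>\<^bsub>T\<^esub> g)}"

definition colim_group :: "('o, 'a, 'z) preadd_data_scheme \<Rightarrow> (nat \<Rightarrow> 'a) \<Rightarrow> 'o \<Rightarrow>
    (nat \<times> 'a) set monoid" where
  "colim_group T e x = \<lparr>
     carrier = (SIGMA n : UNIV. homs T x (Dom T (e n))) // colim_rel T e x,
     mult = (\<lambda>P Q. \<Union>(m, f) \<in> P. \<Union>(n, g) \<in> Q. colim_rel T e x ``
       {(max m n, (trans_map T e m (max m n) \<cdot>\<^bsub>T\<^esub> f) \<boxplus>\<^bsub>T\<^esub> (trans_map T e n (max m n) \<cdot>\<^bsub>T\<^esub> g))}),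
     one = colim_rel T e x `` {(0, Zero T x (Dom T (e 0)))}\<rparr>"

definition colim_yoneda :: "('o, 'a, 'z) preadd_data_scheme \<Rightarrow> (nat \<Rightarrow> 'a) \<Rightarrow>
    ('o, 'a, (nat \<times> 'a) set) presheaf" where
  "colim_yoneda T e = \<lparr>
     Grp = (\<lambda>x \<in> Obj T. colim_group T e x),
     Act = (\<lambda>f \<in> Arr T. \<lambda>P \<in> carrier (colim_group T e (Cod T f)).
       \<Union>(n, g) \<in> P. colim_rel T e (Dom T f) `` {(n, g \<cdot>\<^bsub>T\<^esub> f)})\<rparr>"

text \<open>The arrow of colimits induced by a morphism \<open>u\<close> of sequences from \<open>d\<close> to \<open>e\<close>.\<close>

definition seq_morphism :: "('o, 'a, 'z) cat_data_scheme \<Rightarrow>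
    (nat \<Rightarrow> 'a) \<Rightarrow> (nat \<Rightarrow> 'a) \<Rightarrow> (nat \<Rightarrow> 'a) \<Rightarrow> bool" where
  "seq_morphism T d e u \<longleftrightarrow> (\<forall>n. u n \<in> homs T (Dom T (d n)) (Dom T (e n)) \<and>
     u (Suc n) \<cdot>\<^bsub>T\<^esub> d n = e n \<cdot>\<^bsub>T\<^esub> u n)"

definition colim_map :: "('o, 'a, 'z) preadd_data_scheme \<Rightarrow>
    (nat \<Rightarrow> 'a) \<Rightarrow> (nat \<Rightarrow> 'a) \<Rightarrow> (nat \<Rightarrow> 'a) \<Rightarrow> 'o \<Rightarrow> (nat \<times> 'a) set \<Rightarrow> (nat \<times> 'a) set" where
  "colim_map T d e u = (\<lambda>x \<in> Obj T. \<lambda>P \<in> carrier (colim_group T d x).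
     \<Union>(n, g) \<in> P. colim_rel T e x `` {(n, u n \<cdot>\<^bsub>T\<^esub> g)})"

text \<open>The canonical isomorphism from \<open>\<Sigma>(colim Y(e))\<close> to \<open>colim Y(\<Sigma>e)\<close>, induced by the
  isomorphisms \<open>\<Sigma> : Hom(\<Sigma>\<inverse>x, E\<^sub>n) \<rightarrow> Hom(x, \<Sigma>E\<^sub>n)\<close>.\<close>

definition colim_shift :: "('o, 'a, 'z) tri_data_scheme \<Rightarrow>
    (nat \<Rightarrow> 'a) \<Rightarrow> 'o \<Rightarrow> (nat \<times> 'a) set \<Rightarrow> (nat \<times> 'a) set" where
  "colim_shift T e = (\<lambda>x \<in> Obj T. \<lambda>P \<in> carrier (colim_group T e (ShO_inv T x)).
     \<Union>(n, g) \<in> P. colim_rel T (\<lambda>n. ShA T (e n)) x `` {(n, ShA T g)})"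


section \<open>The completion\<close>

definition compactly_supported :: "('o, 'a, 'z) tri_data_scheme \<Rightarrow> (nat \<Rightarrow> 'o set) \<Rightarrow>
    ('o, 'a, 'm) presheaf set" where
  "compactly_supported T B =
     (\<Inter>j :: int. \<Union>i. right_perp T (yoneda T ` shift_pow T j ` B i))"

definition pre_completion :: "('o, 'a, 'z) tri_data_scheme \<Rightarrow> (nat \<Rightarrow> 'o set) \<Rightarrow>
    ('o, 'a, 'm) presheaf set" where
  "pre_completion T B =
     {F \<in> modules T. \<exists>e. good_Cauchy T B e \<and> nat_isos T F (colim_yoneda T e) \<noteq> {}}"

text \<open>\<open>p \<rightarrow> q \<rightarrow> r \<rightarrow> \<Sigma>p\<close> is an \<open>\<nat>\<close>-indexed diagram of distinguished triangles, formed by good Cauchy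
  sequences.\<close>

definition Cauchy_triangles :: "('o, 'a, 'z) tri_data_scheme \<Rightarrow> (nat \<Rightarrow> 'o set) \<Rightarrow>
    (nat \<Rightarrow> 'a) \<Rightarrow> (nat \<Rightarrow> 'a) \<Rightarrow> (nat \<Rightarrow> 'a) \<Rightarrow>
    (nat \<Rightarrow> 'a) \<Rightarrow> (nat \<Rightarrow> 'a) \<Rightarrow> (nat \<Rightarrow> 'a) \<Rightarrow> bool" where
  "Cauchy_triangles T B p q r \<alpha> \<beta> \<gamma> \<longleftrightarrow>
     good_Cauchy T B p \<and> good_Cauchy T B q \<and> good_Cauchy T B r \<and>
     good_Cauchy T B (\<lambda>n. ShA T (p n)) \<and>
     seq_morphism T p q \<alpha> \<and> seq_morphism T q r \<beta> \<and> seq_morphism T r (\<lambda>n. ShA T (p n)) \<gamma> \<and>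
     (\<forall>n. (\<alpha> n, \<beta> n, \<gamma> n) \<in> Tri T)"

text \<open>The vertical maps of an isomorphism from \<open>F \<rightarrow> G \<rightarrow> H \<rightarrow> \<Sigma>F\<close> to the colimit of such a diagram
  are \<open>\<phi>\<close>, \<open>\<psi>\<close>, \<open>\<chi>\<close> and \<open>\<Sigma>\<phi>\<close>, the latter composed with the canonical isomorphism.\<close>

definition completion :: "('o, 'a, 'z) tri_data_scheme \<Rightarrow> (nat \<Rightarrow> 'o set) \<Rightarrow>
    (('o, 'a, 'm) presheaf, ('o, 'a, 'm) presheaf_map) tri_data" where
  "completion T B = (let S = compactly_supported T B \<inter> pre_completion T B in \<lparr>
     Obj = S,
     Arr = {(F, \<eta>, G). F \<in> S \<and> G \<in> S \<and> (F, \<eta>, G) \<in> Arr (Mod T)},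
     Dom = Dom (Mod T),
     Cod = Cod (Mod T),
     Id = Id (Mod T),
     Comp = Comp (Mod T),
     Add = Add (Mod T),
     Zero = Zero (Mod T),
     ShO = shift_mod T,
     ShA = (\<lambda>(F, \<eta>, G). (shift_mod T F, shift_nt T \<eta>, shift_mod T G)),
     Tri = {((F, u, G), (G', v, H), (H', w, F')).
       F \<in> S \<and> G \<in> S \<and> H \<in> S \<and> G' = G \<and> H' = H \<and> F' = shift_mod T F \<and>
       u \<in> nat_trans T F G \<and> v \<in> nat_trans T G H \<and> w \<in> nat_trans T H (shift_mod T F) \<and>
       (\<exists>p q r \<alpha> \<beta> \<gamma>. Cauchy_triangles T B p q r \<alpha> \<beta> \<gamma> \<and>
         (\<exists>\<phi> \<in> nat_isos T F (colim_yoneda T p).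
          \<exists>\<psi> \<in> nat_isos T G (colim_yoneda T q).
          \<exists>\<chi> \<in> nat_isos T H (colim_yoneda T r).
            nt_comp T F (colim_map T p q \<alpha>) \<phi> = nt_comp T F \<psi> u \<and>
            nt_comp T G (colim_map T q r \<beta>) \<psi> = nt_comp T G \<chi> v \<and>
            nt_comp T H (colim_map T r (\<lambda>n. ShA T (p n)) \<gamma>) \<chi> =
              nt_comp T H (colim_shift T p) (nt_comp T H (shift_nt T \<phi>) w)))}\<rparr>)"

end

theory Submission
  imports Defs
begin

text \<open>
  Being a good Cauchy sequence is a condition on \<^emph>\<open>all\<close> shifts of the cones of a sequence, while the
  \<open>n\<close>-th member of the improvement contains every object whose shifts by at most \<open>n\<close> steps in either
  direction lie in the \<open>n\<close>-th member of the given metric.  Hence the two metrics have the same good Cauchy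
  sequences (\<open>good_Cauchy_improvement_iff\<close>).  They therefore have the same pre-completion, and a triangle
  of modules is a colimit of triangles of good Cauchy sequences for one metric if and only if it is for the
  other.  As the members of the improvement are smaller, compact support with respect to the given metric
  implies compact support with respect to the improvement.  So the completion for the given metric consists
  of those objects of the completion for the improvement that are compactly supported with respect to the
  given metric, with the restricted triangles.

  What remains is that this set of objects is closed under the operations of a triangulated subcategory.
  By the Yoneda lemma, compact support of \<open>F\<close> means that for each \<open>j\<close> there is an \<open>i\<close> such that \<open>F\<close> vanishes
  on the objects \<open>\<Sigma>\<^sup>j c\<close> with \<open>c\<close> in the \<open>i\<close>-th member of the metric (\<open>compactly_supported_iff\<close>).  This is
  inherited by retracts, biproducts and shifts.  It has the two-out-of-three property for colimits of
  distinguished triangles, because evaluating such a colimit at an object gives a long exact sequence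
  (\<open>colim_triangle_vanishes\<close>): each \<open>Hom(c, -)\<close> is exact on distinguished triangles, and exactness passes to
  sequential colimits.

  Colimits are handled by a choice of elements \<open>\<xi>\<^sub>n \<in> F(E\<^sub>n)\<close> (\<open>colim_presentation\<close>) in place of an isomorphism
  \<open>F \<cong> colim Y(E)\<close>, so that statements about colimits become statements about representatives
  \<open>x \<rightarrow> E\<^sub>n\<close>.
\<close>

section \<open>Additive and triangulated categories\<close>

context category
begin

lemma homs_Obj:
  assumes "f \<in> homs T x y"
  shows "x \<in> Obj T" "y \<in> Obj T"
  using assms Dom_closed Cod_closed by (auto simp: homs_def)

lemma homsD:
  assumes "f \<in> homs T x y"
  shows "f \<in> Arr T" "Dom T f = x" "Cod T f = y"
  using assms by (auto simp: homs_def)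

lemma Arr_homs: "f \<in> Arr T \<Longrightarrow> f \<in> homs T (Dom T f) (Cod T f)"
  by (simp add: homs_def)

lemma Id_isos: "x \<in> Obj T \<Longrightarrow> Id T x \<in> isos T x x"
  using Id_closed Id_left by (auto simp: isos_def)

lemma zero_object_Obj: "zero_object T z \<Longrightarrow> z \<in> Obj T"
  by (simp add: zero_object_def)

lemma zero_object_from_eq:
  "zero_object T z \<Longrightarrow> f \<in> homs T z x \<Longrightarrow> g \<in> homs T z x \<Longrightarrow> f = g"
  using homs_Obj unfolding zero_object_def by blast

lemma zero_object_to_eq:
  "zero_object T z \<Longrightarrow> f \<in> homs T x z \<Longrightarrow> g \<in> homs T x z \<Longrightarrow> f = g"
  using homs_Obj unfolding zero_object_def by blast

lemma isos_zero_objects: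
  assumes "zero_object T z" "zero_object T d"
  obtains b where "b \<in> isos T z d"
proof -
  have "\<exists>!b. b \<in> homs T z d" "\<exists>!c. c \<in> homs T d z"
    using assms by (simp_all add: zero_object_def)
  then obtain b c where b: "b \<in> homs T z d" and c: "c \<in> homs T d z"
    by (meson ex1_implies_ex)
  have "c \<cdot> b = Id T z"
    using zero_object_from_eq[OF assms(1) Comp_closed[OF b c] Id_closed] zero_object_Obj assms(1) by simp
  moreover have "b \<cdot> c = Id T d"
    using zero_object_from_eq[OF assms(2) Comp_closed[OF c b] Id_closed] zero_object_Obj assms(2) by simp
  ultimately show thesis
    using b c that unfolding isos_def by blast
qed

lemma trans_map_refl: "trans_map T e m m = Id T (Dom T (e m))"
  by (simp add: trans_map_def)

lemma trans_map_Suc: "m \<le> n \<Longrightarrow> trans_map T e m (Suc n) = e n \<cdot> trans_map T e m n"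
  by (simp add: trans_map_def Suc_diff_le)

lemma sequence_homs: "sequence T e \<Longrightarrow> e n \<in> homs T (Dom T (e n)) (Dom T (e (Suc n)))"
  by (simp add: sequence_def)

lemma sequence_Obj: "sequence T e \<Longrightarrow> Dom T (e n) \<in> Obj T"
  using homs_Obj sequence_homs by blast

lemma trans_map_closed:
  assumes "sequence T e" "m \<le> n"
  shows "trans_map T e m n \<in> homs T (Dom T (e m)) (Dom T (e n))"
  using assms(2)
proof (induction n rule: dec_induct)
  case base
  then show ?case
    using assms(1) by (simp add: trans_map_refl Id_closed sequence_Obj)
next
  case (step n)
  then show ?case
    using Comp_closed[OF step(3) sequence_homs[OF assms(1)]] by (simp add: trans_map_Suc)
qed

lemma trans_map_comp:
  assumes "sequence T e" "m \<le> k" "k \<le> n"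
  shows "trans_map T e k n \<cdot> trans_map T e m k = trans_map T e m n"
  using assms(3)
proof (induction n rule: dec_induct)
  case base
  then show ?case
    using Id_left trans_map_closed[OF assms(1,2)] by (simp add: trans_map_refl)
next
  case (step n)
  then show ?case
    using assms Comp_assoc[OF trans_map_closed[OF assms(1,2)] trans_map_closed[OF assms(1)]
        sequence_homs[OF assms(1)], of n]
    by (simp add: trans_map_Suc)
qed

lemma seq_morphism_trans_map:
  assumes "sequence T d" "sequence T e" "seq_morphism T d e u" "m \<le> n"
  shows "u n \<cdot> trans_map T d m n = trans_map T e m n \<cdot> u m"
  using assms(4)
proof (induction n rule: dec_induct)
  case base
  have "u m \<in> homs T (Dom T (d m)) (Dom T (e m))"
    using assms(3) by (simp add: seq_morphism_def)
  then show ?case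
    by (simp add: trans_map_refl Id_left Id_right)
next
  case (step n)
  have u: "u k \<in> homs T (Dom T (d k)) (Dom T (e k))" "u (Suc k) \<cdot> d k = e k \<cdot> u k" for k
    using assms(3) by (simp_all add: seq_morphism_def)
  note td = trans_map_closed[OF assms(1) step(1)] and te = trans_map_closed[OF assms(2) step(1)]
  have "u (Suc n) \<cdot> (d n \<cdot> trans_map T d m n) = (u (Suc n) \<cdot> d n) \<cdot> trans_map T d m n"
    using Comp_assoc[OF td sequence_homs[OF assms(1)] u(1)] by simp
  also have "\<dots> = e n \<cdot> (u n \<cdot> trans_map T d m n)"
    using Comp_assoc[OF td u(1) sequence_homs[OF assms(2)]] by (simp add: u(2))
  also have "\<dots> = e n \<cdot> (trans_map T e m n \<cdot> u m)"
    using step by simp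
  also have "\<dots> = (e n \<cdot> trans_map T e m n) \<cdot> u m"
    using Comp_assoc[OF u(1) te sequence_homs[OF assms(2)]] by simp
  finally show ?case
    using step by (simp add: trans_map_Suc)
qed

end

context additive_category
begin

lemma hom_group_group: "x \<in> Obj T \<Longrightarrow> y \<in> Obj T \<Longrightarrow> group (hom_group T x y)"
  using hom_comm_group comm_group.axioms(2) by blast

lemma Zero_closed: "x \<in> Obj T \<Longrightarrow> y \<in> Obj T \<Longrightarrow> Zero T x y \<in> homs T x y"
  using monoid.one_closed[OF group.is_monoid[OF hom_group_group], of x y]
  by (simp add: hom_group_def)

lemma Add_closed: "f \<in> homs T x y \<Longrightarrow> g \<in> homs T x y \<Longrightarrow> f \<boxplus> g \<in> homs T x y"
  using homs_Obj monoid.m_closed[OF group.is_monoid[OF hom_group_group], of x y f g]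
  by (simp add: hom_group_def)

lemma Add_cancel_self:
  assumes "f \<in> homs T x y" "f \<boxplus> f = f"
  shows "f = Zero T x y"
proof -
  interpret group "hom_group T x y"
    using homs_Obj[OF assms(1)] hom_group_group by blast
  show ?thesis
    using l_cancel_one[of f f] assms by (simp add: hom_group_def)
qed

lemma Zero_Add_Zero: "x \<in> Obj T \<Longrightarrow> y \<in> Obj T \<Longrightarrow> Zero T x y \<boxplus> Zero T x y = Zero T x y"
  using monoid.l_one[OF group.is_monoid[OF hom_group_group], of x y "Zero T x y"] Zero_closed
  by (simp add: hom_group_def)

lemma Comp_Zero_right:
  assumes "g \<in> homs T y z" "x \<in> Obj T"
  shows "g \<cdot> Zero T x y = Zero T x z"
proof -
  have z: "Zero T x y \<in> homs T x y" and y: "y \<in> Obj T"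
    using Zero_closed homs_Obj[OF assms(1)] assms(2) by auto
  show ?thesis
    using Add_cancel_self[OF Comp_closed[OF z assms(1)]] Comp_Add_right[OF z z assms(1)]
    by (simp add: Zero_Add_Zero assms(2) y)
qed

lemma Comp_Zero_left:
  assumes "f \<in> homs T x y" "z \<in> Obj T"
  shows "Zero T y z \<cdot> f = Zero T x z"
proof -
  have z: "Zero T y z \<in> homs T y z" and y: "y \<in> Obj T"
    using Zero_closed homs_Obj[OF assms(1)] assms(2) by auto
  show ?thesis
    using Add_cancel_self[OF Comp_closed[OF assms(1) z]] Comp_Add_left[OF assms(1) z z]
    by (simp add: Zero_Add_Zero assms(2) y)
qed

lemma neg_closed: "f \<in> homs T x y \<Longrightarrow> neg T f \<in> homs T x y"
  using homs_Obj homsD group.inv_closed[OF hom_group_group, of x y f]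
  by (simp add: neg_def) (simp add: hom_group_def)

lemma neg_eqI:
  assumes "f \<in> homs T x y" "g \<in> homs T x y" "g \<boxplus> f = Zero T x y"
  shows "neg T f = g"
  using assms homs_Obj homsD group.inv_equality[OF hom_group_group, of x y g f]
  by (simp add: neg_def) (simp add: hom_group_def)

lemma neg_Add: "f \<in> homs T x y \<Longrightarrow> neg T f \<boxplus> f = Zero T x y"
  using homs_Obj homsD group.l_inv[OF hom_group_group, of x y f]
  by (simp add: neg_def) (simp add: hom_group_def)

lemma neg_neg: "f \<in> homs T x y \<Longrightarrow> neg T (neg T f) = f"
  using homs_Obj homsD[OF neg_closed] homsD group.inv_inv[OF hom_group_group, of x y f]
  by (simp add: neg_def) (simp add: hom_group_def)

lemma neg_Zero: "x \<in> Obj T \<Longrightarrow> y \<in> Obj T \<Longrightarrow> neg T (Zero T x y) = Zero T x y"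
  by (rule neg_eqI[OF Zero_closed Zero_closed Zero_Add_Zero])

lemma neg_Comp_left:
  assumes "f \<in> homs T x y" "g \<in> homs T y z"
  shows "neg T g \<cdot> f = neg T (g \<cdot> f)"
  using neg_eqI[OF Comp_closed[OF assms] Comp_closed[OF assms(1) neg_closed[OF assms(2)]]]
    Comp_Add_left[OF assms(1) neg_closed[OF assms(2)] assms(2)] neg_Add[OF assms(2)]
    Comp_Zero_left[OF assms(1)] homs_Obj[OF assms(2)] by simp

lemma neg_Comp_right:
  assumes "f \<in> homs T x y" "g \<in> homs T y z"
  shows "g \<cdot> neg T f = neg T (g \<cdot> f)"
  using neg_eqI[OF Comp_closed[OF assms] Comp_closed[OF neg_closed[OF assms(1)] assms(2)]]
    Comp_Add_right[OF neg_closed[OF assms(1)] assms(1) assms(2)] neg_Add[OF assms(1)]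
    Comp_Zero_right[OF assms(2)] homs_Obj[OF assms(1)] by simp

lemma neg_Id_isos: "x \<in> Obj T \<Longrightarrow> neg T (Id T x) \<in> isos T x x"
  using neg_closed[OF Id_closed] neg_Comp_left[OF neg_closed[OF Id_closed] Id_closed]
    Id_left[OF neg_closed[OF Id_closed]] neg_neg[OF Id_closed]
  by (auto simp: isos_def)

text \<open>This equational form shows that additive functors preserve zero objects.\<close>

lemma zero_object_iff: "zero_object T z \<longleftrightarrow> z \<in> Obj T \<and> Id T z = Zero T z z"
proof (intro iffI conjI)
  assume z: "zero_object T z"
  show zO: "z \<in> Obj T"
    using z by (rule zero_object_Obj)
  show "Id T z = Zero T z z"
    by (rule zero_object_to_eq[OF z Id_closed[OF zO] Zero_closed[OF zO zO]])
next
  assume z: "z \<in> Obj T \<and> Id T z = Zero T z z"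
  have from_z: "f = Zero T z x" if f: "f \<in> homs T z x" for f x
    using Id_right[OF f] Comp_Zero_right[OF f] z by simp
  have to_z: "f = Zero T x z" if f: "f \<in> homs T x z" for f x
    using Id_left[OF f] Comp_Zero_left[OF f] z by simp
  show "zero_object T z"
    unfolding zero_object_def
  proof (intro conjI ballI)
    fix x assume x: "x \<in> Obj T"
    show "\<exists>!f. f \<in> homs T z x"
      using z x by (intro ex1I[of _ "Zero T z x"] Zero_closed from_z) simp_all
    show "\<exists>!f. f \<in> homs T x z"
      using z x by (intro ex1I[of _ "Zero T x z"] Zero_closed to_z) simp_all
  qed (use z in simp)
qed

end

text \<open>Both the shift and its inverse are used to transport modules and sequences, and each construction
  for one of them is needed for the other as well; so they are treated as instances of an automorphism
  together with its inverse.\<close>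

locale additive_endofunctor = additive_category T
  for T :: "('o, 'a, 'z) preadd_data_scheme" (structure)
    and FO :: "'o \<Rightarrow> 'o" and FA :: "'a \<Rightarrow> 'a" +
  assumes FO_closed: "x \<in> Obj T \<Longrightarrow> FO x \<in> Obj T"
    and FA_closed: "f \<in> homs T x y \<Longrightarrow> FA f \<in> homs T (FO x) (FO y)"
    and FA_Id: "x \<in> Obj T \<Longrightarrow> FA (Id T x) = Id T (FO x)"
    and FA_Comp: "f \<in> homs T x y \<Longrightarrow> g \<in> homs T y z \<Longrightarrow> FA (g \<cdot> f) = FA g \<cdot> FA f"
    and FA_Add: "f \<in> homs T x y \<Longrightarrow> g \<in> homs T x y \<Longrightarrow> FA (f \<boxplus> g) = FA f \<boxplus> FA g"
begin

lemma FA_Arr: "f \<in> Arr T \<Longrightarrow> FA f \<in> Arr T \<and> Dom T (FA f) = FO (Dom T f) \<and> Cod T (FA f) = FO (Cod T f)"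
  using FA_closed[OF Arr_homs] homsD by blast

lemma FA_Zero: "x \<in> Obj T \<Longrightarrow> y \<in> Obj T \<Longrightarrow> FA (Zero T x y) = Zero T (FO x) (FO y)"
  using Add_cancel_self[OF FA_closed[OF Zero_closed]] FA_Add[OF Zero_closed Zero_closed]
  by (simp add: Zero_Add_Zero)

lemma zero_object_image: "zero_object T z \<Longrightarrow> zero_object T (FO z)"
  by (simp add: zero_object_iff FO_closed FA_Id[symmetric] FA_Zero[symmetric])

lemma sequence_image:
  assumes "sequence T e"
  shows "sequence T (\<lambda>n. FA (e n))" "Dom T (FA (e n)) = FO (Dom T (e n))"
  using assms FA_closed homsD unfolding sequence_def by (metis, metis)

lemma trans_map_image:
  assumes "sequence T e" "m \<le> n"
  shows "trans_map T (\<lambda>n. FA (e n)) m n = FA (trans_map T e m n)"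
  using assms(2)
proof (induction n rule: dec_induct)
  case base
  then show ?case
    by (simp add: trans_map_refl sequence_image(2) FA_Id sequence_Obj assms(1))
next
  case (step n)
  then show ?case
    using FA_Comp[OF trans_map_closed[OF assms(1)] sequence_homs[OF assms(1)], of m n]
    by (simp add: trans_map_Suc)
qed

end

locale additive_automorphism = additive_endofunctor T FO FA + inverse: additive_endofunctor T GO GA
  for T :: "('o, 'a, 'z) preadd_data_scheme" (structure) and FO FA GO GA +
  assumes GO_FO: "x \<in> Obj T \<Longrightarrow> GO (FO x) = x"
    and FO_GO: "x \<in> Obj T \<Longrightarrow> FO (GO x) = x"
    and GA_FA: "f \<in> Arr T \<Longrightarrow> GA (FA f) = f"
    and FA_GA: "f \<in> Arr T \<Longrightarrow> FA (GA f) = f"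

context triangulated_category
begin

lemma ShO_closed: "x \<in> Obj T \<Longrightarrow> ShO T x \<in> Obj T"
  using ShO_bij bij_betwE by blast

lemma ShO_inv_closed: "x \<in> Obj T \<Longrightarrow> ShO_inv T x \<in> Obj T"
  unfolding ShO_inv_def using ShO_bij by (metis bij_betw_imp_surj_on inv_into_into)

lemma ShO_ShO_inv: "x \<in> Obj T \<Longrightarrow> ShO T (ShO_inv T x) = x"
  unfolding ShO_inv_def using ShO_bij by (metis bij_betw_imp_surj_on f_inv_into_f)

lemma ShO_inv_ShO: "x \<in> Obj T \<Longrightarrow> ShO_inv T (ShO T x) = x"
  unfolding ShO_inv_def using ShO_bij by (metis bij_betw_imp_inj_on inv_into_f_f)

lemma ShA_Arr: "f \<in> Arr T \<Longrightarrow> ShA T f \<in> Arr T"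
  using ShA_bij bij_betwE by blast

lemma ShA_inv_Arr: "f \<in> Arr T \<Longrightarrow> ShA_inv T f \<in> Arr T"
  unfolding ShA_inv_def using ShA_bij by (metis bij_betw_imp_surj_on inv_into_into)

lemma ShA_ShA_inv: "f \<in> Arr T \<Longrightarrow> ShA T (ShA_inv T f) = f"
  unfolding ShA_inv_def using ShA_bij by (metis bij_betw_imp_surj_on f_inv_into_f)

lemma ShA_inv_ShA: "f \<in> Arr T \<Longrightarrow> ShA_inv T (ShA T f) = f"
  unfolding ShA_inv_def using ShA_bij by (metis bij_betw_imp_inj_on inv_into_f_f)

lemma ShA_inv_closed:
  assumes "f \<in> homs T x y"
  shows "ShA_inv T f \<in> homs T (ShO_inv T x) (ShO_inv T y)"
proof -
  have f: "f \<in> Arr T" "Dom T f = x" "Cod T f = y"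
    using homsD assms by blast+
  let ?g = "ShA_inv T f"
  have g: "?g \<in> homs T (Dom T ?g) (Cod T ?g)"
    using Arr_homs ShA_inv_Arr f by blast
  have "ShO T (Dom T ?g) = x" "ShO T (Cod T ?g) = y"
    using homsD[OF ShA_closed[OF g]] f by (simp_all add: ShA_ShA_inv)
  then show ?thesis
    using g homs_Obj[OF g] ShO_inv_ShO by metis
qed

lemma ShA_inv_eqI: "ShA T g = f \<Longrightarrow> g \<in> Arr T \<Longrightarrow> ShA_inv T f = g"
  using ShA_inv_ShA by blast

lemma shift_automorphism: "additive_automorphism T (ShO T) (ShA T) (ShO_inv T) (ShA_inv T)"
proof (unfold_locales, goal_cases)
  case (8 x)
  then show ?case
    using ShA_inv_eqI[of "Id T (ShO_inv T x)" "Id T x"] homsD[OF Id_closed] ShO_inv_closed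
    by (simp add: ShA_Id ShO_ShO_inv)
next
  case (9 f x y g z)
  note f = ShA_inv_closed[OF 9(1)] and g = ShA_inv_closed[OF 9(2)]
  show ?case
    using ShA_inv_eqI[OF _ homsD(1)[OF Comp_closed[OF f g]]] ShA_Comp[OF f g] 9 homsD(1)
    by (simp add: ShA_ShA_inv)
next
  case (10 f x y g)
  note f = ShA_inv_closed[OF 10(1)] and g = ShA_inv_closed[OF 10(2)]
  show ?case
    using ShA_inv_eqI[OF _ homsD(1)[OF Add_closed[OF f g]]] ShA_Add[OF f g] 10 homsD(1)
    by (simp add: ShA_ShA_inv)
qed (simp_all add: ShO_closed ShA_closed ShA_Id ShA_Comp ShA_Add ShO_inv_closed ShA_inv_closed
    ShO_ShO_inv ShO_inv_ShO ShA_ShA_inv ShA_inv_ShA)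

lemma shift_inv_automorphism:
  "additive_automorphism T (ShO_inv T) (ShA_inv T) (ShO T) (ShA T)"
  using shift_automorphism
  unfolding additive_automorphism_def additive_automorphism_axioms_def by blast

lemma shift_pow_0: "shift_pow T 0 x = x"
  by (simp add: shift_pow_def)

lemma shift_pow_closed:
  assumes "x \<in> Obj T"
  shows "shift_pow T j x \<in> Obj T"
proof -
  have "(ShO T ^^ k) x \<in> Obj T" "(ShO_inv T ^^ k) x \<in> Obj T" for k
    by (induction k) (use assms ShO_closed ShO_inv_closed in auto)
  then show ?thesis
    by (simp add: shift_pow_def)
qed

lemma ShO_shift_pow:
  assumes "x \<in> Obj T"
  shows "ShO T (shift_pow T j x) = shift_pow T (j + 1) x"
proof (cases "j \<ge> 0")
  case True
  then show ?thesis
    by (simp add: shift_pow_def nat_add_distrib)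
next
  case False
  then obtain k where k: "j = - int (Suc k)"
    using int_cases[of j] by (metis neg_0_le_iff_le of_nat_0_le_iff)
  have 1: "shift_pow T j x = ShO_inv T ((ShO_inv T ^^ k) x)"
    by (simp add: shift_pow_def k nat_add_distrib)
  have 2: "shift_pow T (j + 1) x = (ShO_inv T ^^ k) x"
    by (simp add: shift_pow_def k)
  show ?thesis
    using shift_pow_closed[OF assms, of "j + 1"] unfolding 1 2 by (rule ShO_ShO_inv)
qed

lemma ShO_inv_shift_pow:
  assumes "x \<in> Obj T"
  shows "ShO_inv T (shift_pow T j x) = shift_pow T (j - 1) x"
  using ShO_shift_pow[OF assms, of "j - 1"] ShO_inv_ShO[OF shift_pow_closed[OF assms]]
  by (metis diff_add_cancel)

lemma shift_pow_add:
  assumes "x \<in> Obj T"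
  shows "shift_pow T j (shift_pow T k x) = shift_pow T (j + k) x"
proof (induction j rule: int_induct[where k = 0])
  case base
  then show ?case by (simp add: shift_pow_0)
next
  case (step1 j)
  then show ?case
    using ShO_shift_pow[OF assms, of "j + k"] ShO_shift_pow[OF shift_pow_closed[OF assms], of j k]
    by (simp add: algebra_simps)
next
  case (step2 j)
  then show ?case
    using ShO_inv_shift_pow[OF assms, of "j + k"] ShO_inv_shift_pow[OF shift_pow_closed[OF assms], of j k]
    by (simp add: algebra_simps)
qed

lemma ShO_eq_shift_pow: "x \<in> Obj T \<Longrightarrow> ShO T x = shift_pow T 1 x"
  using ShO_shift_pow[of x 0] by (simp add: shift_pow_0)

lemma ShO_inv_eq_shift_pow: "x \<in> Obj T \<Longrightarrow> ShO_inv T x = shift_pow T (- 1) x"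
  using ShO_inv_shift_pow[of x 0] by (simp add: shift_pow_0)

sublocale shift: additive_automorphism T "ShO T" "ShA T" "ShO_inv T" "ShA_inv T"
  by (rule shift_automorphism)

sublocale shift_inv: additive_automorphism T "ShO_inv T" "ShA_inv T" "ShO T" "ShA T"
  by (rule shift_inv_automorphism)

lemma shift_pow_zero_object:
  assumes "zero_object T z"
  shows "zero_object T (shift_pow T j z)"
proof -
  have "zero_object T ((ShO T ^^ k) z)" "zero_object T ((ShO_inv T ^^ k) z)" for k
    by (induction k) (simp_all add: assms shift.zero_object_image shift.inverse.zero_object_image)
  then show ?thesis
    by (simp add: shift_pow_def)
qed

lemma Tri_homs:
  assumes "(f, g, h) \<in> Tri T"
  shows "f \<in> homs T (Dom T f) (Cod T f)" "g \<in> homs T (Cod T f) (Cod T g)"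
    "h \<in> homs T (Cod T g) (ShO T (Dom T f))"
proof -
  obtain x y z where homs: "f \<in> homs T x y" "g \<in> homs T y z" "h \<in> homs T z (ShO T x)"
    using Tri_closed[OF assms] by blast
  then show "f \<in> homs T (Dom T f) (Cod T f)" "g \<in> homs T (Cod T f) (Cod T g)"
    "h \<in> homs T (Cod T g) (ShO T (Dom T f))"
    using homsD[OF homs(1)] homsD[OF homs(2)] by simp_all
qed

lemma Tri_rotate:
  assumes "(f, g, h) \<in> Tri T"
  shows "(g, h, neg T (ShA T f)) \<in> Tri T"
  using TR2[OF Tri_homs[OF assms]] assms by blast

text \<open>A lift of \<open>s\<close> along \<open>f\<close> is the missing part of a morphism of triangles from \<open>c \<rightarrow> c \<rightarrow> 0\<close> to
  \<open>(f, g, h)\<close> that is \<open>s\<close> on the second and zero on the third vertex.  As TR3 prescribes the first two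
  vertices, both triangles are rotated first; the lift then appears shifted, and with a sign on both
  sides of the equation that it satisfies.\<close>

lemma Tri_exact1:
  assumes tri: "(f, g, h) \<in> Tri T" and s: "s \<in> homs T c (Cod T f)"
    and gs: "g \<cdot> s = Zero T c (Cod T g)"
  obtains t where "t \<in> homs T c (Dom T f)" "f \<cdot> t = s"
proof -
  note homs = Tri_homs[OF tri]
  have c: "c \<in> Obj T" and x: "Dom T f \<in> Obj T" and z': "Cod T g \<in> Obj T"
    using homs_Obj s homs by blast+
  obtain z where z: "zero_object T z"
    using ex_zero_object by blast
  then have zO: "z \<in> Obj T"
    by (rule zero_object_Obj)
  have Sc: "ShO T c \<in> Obj T"
    by (rule ShO_closed[OF c])
  have 1: "(Zero T c z, Zero T z (ShO T c), neg T (ShA T (Id T c))) \<in> Tri T"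
    by (rule Tri_rotate[OF TR1_Id[OF c z]])
  note Z = homsD[OF Zero_closed[OF c zO]] homsD[OF Zero_closed[OF zO Sc]]
  have "\<exists>k \<in> homs T (Cod T (Zero T z (ShO T c))) (Cod T h).
      h \<cdot> Zero T z (Cod T g) = k \<cdot> Zero T z (ShO T c) \<and>
      neg T (ShA T f) \<cdot> k = ShA T s \<cdot> neg T (ShA T (Id T c))"
  proof (rule TR3[OF 1 Tri_rotate[OF tri]])
    show "s \<in> homs T (Dom T (Zero T c z)) (Dom T g)"
      using s Z homsD[OF homs(2)] by simp
    show "Zero T z (Cod T g) \<in> homs T (Cod T (Zero T c z)) (Cod T g)"
      using Zero_closed zO z' Z by simp
    show "g \<cdot> s = Zero T z (Cod T g) \<cdot> Zero T c z"
      using gs Comp_Zero_right[OF Zero_closed[OF zO z'] c] by simp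
  qed
  then obtain k where k: "k \<in> homs T (ShO T c) (ShO T (Dom T f))"
    and eq: "neg T (ShA T f) \<cdot> k = ShA T s \<cdot> neg T (ShA T (Id T c))"
    using Z homsD[OF homs(3)] by auto
  note Sf = ShA_closed[OF homs(1)] and Ss = ShA_closed[OF s]
  have "neg T (ShA T f \<cdot> k) = neg T (ShA T s)"
    using eq neg_Comp_left[OF k Sf] neg_Comp_right[OF Id_closed[OF Sc] Ss] Id_right[OF Ss]
    by (simp add: ShA_Id c)
  then have Sfk: "ShA T f \<cdot> k = ShA T s"
    using neg_neg[OF Comp_closed[OF k Sf]] neg_neg[OF Ss] by metis
  define t where "t = ShA_inv T k"
  have t: "t \<in> homs T c (Dom T f)"
    using ShA_inv_closed[OF k] c x by (simp add: t_def ShO_inv_ShO)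
  have "ShA T (f \<cdot> t) = ShA T s"
    using ShA_Comp[OF t homs(1)] Sfk ShA_ShA_inv homsD(1)[OF k] by (simp add: t_def)
  then have "f \<cdot> t = s"
    using ShA_inv_ShA homsD(1)[OF s] homsD(1)[OF Comp_closed[OF t homs(1)]] by metis
  with t show thesis by (rule that)
qed

lemma Tri_exact2:
  assumes tri: "(f, g, h) \<in> Tri T" and s: "s \<in> homs T c (Cod T g)"
    and hs: "h \<cdot> s = Zero T c (ShO T (Dom T f))"
  obtains t where "t \<in> homs T c (Cod T f)" "g \<cdot> t = s"
  using Tri_exact1[OF Tri_rotate[OF tri] s] hs homsD[OF Tri_homs(2)[OF tri]]
    homsD[OF Tri_homs(3)[OF tri]] by metis

lemma Tri_exact3:
  assumes tri: "(f, g, h) \<in> Tri T" and s: "s \<in> homs T c (ShO T (Dom T f))"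
    and fs: "ShA T f \<cdot> s = Zero T c (ShO T (Cod T f))"
  obtains t where "t \<in> homs T c (Cod T g)" "h \<cdot> t = s"
proof -
  note homs = Tri_homs[OF tri]
  have c: "c \<in> Obj T" and y: "ShO T (Cod T f) \<in> Obj T"
    using homs_Obj(1)[OF s] homs_Obj(2)[OF ShA_closed[OF homs(1)]] .
  have "s \<in> homs T c (Cod T h)"
    using s homsD[OF homs(3)] by simp
  moreover have "neg T (ShA T f) \<cdot> s = Zero T c (Cod T (neg T (ShA T f)))"
    using neg_Comp_left[OF s ShA_closed[OF homs(1)]] fs homsD[OF neg_closed[OF ShA_closed[OF homs(1)]]]
    by (simp add: neg_Zero c y)
  ultimately obtain t where "t \<in> homs T c (Dom T h)" "h \<cdot> t = s"
    using Tri_exact1[OF Tri_rotate[OF Tri_rotate[OF tri]]] by blast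
  then show thesis
    using that homsD[OF homs(3)] by simp
qed

text \<open>By exactness the identity of the cone factors through \<open>z\<close>, so it is zero.\<close>

lemma cone_Id_zero_object:
  assumes z: "zero_object T z" and cone: "is_cone T (Id T z) d"
  shows "zero_object T d"
proof -
  obtain g h where tri: "(Id T z, g, h) \<in> Tri T" and d: "Cod T g = d"
    using cone by (auto simp: is_cone_def)
  have zO: "z \<in> Obj T"
    using z by (rule zero_object_Obj)
  note I = homsD[OF Id_closed[OF zO]]
  have g: "g \<in> homs T z d" and h: "h \<in> homs T d (ShO T z)"
    using Tri_homs[OF tri] I d by simp_all
  have dO: "d \<in> Obj T"
    using homs_Obj g by blast
  have "h \<cdot> Id T d = Zero T d (ShO T z)"
    using Comp_closed[OF Id_closed[OF dO] h] Zero_closed[OF dO ShO_closed[OF zO]]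
      zero_object_to_eq[OF shift.zero_object_image[OF z]] by blast
  then obtain t where t: "t \<in> homs T d z" and gt: "g \<cdot> t = Id T d"
    using Tri_exact2[OF tri, of "Id T d" d] Id_closed[OF dO] I d by metis
  have "g = Zero T z d"
    using zero_object_from_eq[OF z g Zero_closed[OF zO dO]] .
  then have "Id T d = Zero T d d"
    using gt Comp_Zero_left[OF t dO] by simp
  then show ?thesis
    by (simp add: zero_object_iff dO)
qed

text \<open>Rotating three times shifts a triangle and changes the signs of all three arrows; the first two
  signs are then removed by an isomorphism that is \<open>-Id\<close> on the middle vertex.  Applied to \<open>f\<close> and to
  \<open>\<Sigma>\<^sup>-\<^sup>1 f\<close>, this relates the cones of a morphism to those of its shifts without an appeal to the uniqueness
  of cones.\<close>

lemma Tri_shift_iff: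
  assumes f: "f \<in> homs T x y" and g: "g \<in> homs T y z" and h: "h \<in> homs T z (ShO T x)"
  shows "(f, g, h) \<in> Tri T \<longleftrightarrow> (ShA T f, ShA T g, neg T (ShA T h)) \<in> Tri T"
proof -
  let ?f = "ShA T f" and ?g = "ShA T g" and ?h = "ShA T h"
  note Sf = ShA_closed[OF f] and Sg = ShA_closed[OF g] and Sh = ShA_closed[OF h]
  note nf = neg_closed[OF Sf] and ng = neg_closed[OF Sg] and nh = neg_closed[OF Sh]
  have O: "ShO T x \<in> Obj T" "ShO T y \<in> Obj T" "ShO T z \<in> Obj T"
    using homs_Obj Sf Sg by blast+
  note iso = Id_isos[OF O(1)] neg_Id_isos[OF O(2)] Id_isos[OF O(3)]
  have SI: "ShA T (Id T (ShO T x)) = Id T (ShO T (ShO T x))"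
    by (rule ShA_Id[OF O(1)])
  have right: "u \<cdot> neg T (Id T (ShO T y)) = neg T u" if "u \<in> homs T (ShO T y) w" for u w
    using neg_Comp_right[OF Id_closed[OF O(2)] that] Id_right[OF that] by simp
  have left: "neg T (Id T (ShO T y)) \<cdot> u = neg T u" if "u \<in> homs T w (ShO T y)" for u w
    using neg_Comp_left[OF that Id_closed[OF O(2)]] Id_left[OF that] by simp
  have "(f, g, h) \<in> Tri T \<longleftrightarrow> (neg T ?f, neg T ?g, neg T ?h) \<in> Tri T"
    using TR2[OF f g h] TR2[OF g h nf] TR2[OF h nf ng] by simp
  also have "\<dots> \<longleftrightarrow> (?f, ?g, neg T ?h) \<in> Tri T"
  proof
    assume a: "(neg T ?f, neg T ?g, neg T ?h) \<in> Tri T"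
    show "(?f, ?g, neg T ?h) \<in> Tri T"
      by (rule Tri_iso[OF a nf ng nh Sf Sg nh iso])
        (simp_all add: SI Id_right[OF Sf] left[OF nf] neg_neg[OF Sf] right[OF Sg] Id_left[OF ng]
          Id_left[OF nh] Id_right[OF nh])
  next
    assume a: "(?f, ?g, neg T ?h) \<in> Tri T"
    show "(neg T ?f, neg T ?g, neg T ?h) \<in> Tri T"
      by (rule Tri_iso[OF a Sf Sg nh nf ng nh iso])
        (simp_all add: SI Id_right[OF nf] left[OF Sf] neg_neg[OF Sg] right[OF ng] Id_left[OF Sg]
          Id_left[OF nh] Id_right[OF nh])
  qed
  finally show ?thesis .
qed

lemma is_cone_Obj:
  assumes "is_cone T f d"
  shows "d \<in> Obj T"
proof -
  obtain g h where "(f, g, h) \<in> Tri T" "Cod T g = d"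
    using assms by (auto simp: is_cone_def)
  then show ?thesis
    using Tri_homs(2) homs_Obj(2) by blast
qed

lemma is_cone_ShA:
  assumes "is_cone T f d"
  shows "is_cone T (ShA T f) (ShO T d)"
proof -
  obtain g h where tri: "(f, g, h) \<in> Tri T" and d: "Cod T g = d"
    using assms by (auto simp: is_cone_def)
  show ?thesis
    using Tri_shift_iff[OF Tri_homs[OF tri]] tri d homsD[OF ShA_closed[OF Tri_homs(2)[OF tri]]]
    unfolding is_cone_def by blast
qed

lemma is_cone_ShA_inv:
  assumes "is_cone T f d"
  shows "is_cone T (ShA_inv T f) (ShO_inv T d)"
proof -
  obtain g h where tri: "(f, g, h) \<in> Tri T" and d: "Cod T g = d"
    using assms by (auto simp: is_cone_def)
  note homs = Tri_homs[OF tri]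
  let ?f = "ShA_inv T f" and ?g = "ShA_inv T g" and ?h = "ShA_inv T (neg T h)"
  have x: "Dom T f \<in> Obj T"
    using homs_Obj homs(1) by blast
  have nh: "neg T h \<in> homs T (Cod T g) (ShO T (Dom T f))"
    using homs(3) by (rule neg_closed)
  have h': "?h \<in> homs T (ShO_inv T (Cod T g)) (ShO T (ShO_inv T (Dom T f)))"
    using ShA_inv_closed[OF nh] by (simp add: ShO_inv_ShO ShO_ShO_inv x)
  have "(?f, ?g, ?h) \<in> Tri T \<longleftrightarrow> (f, g, h) \<in> Tri T"
    using Tri_shift_iff[OF ShA_inv_closed[OF homs(1)] ShA_inv_closed[OF homs(2)] h']
      homsD(1)[OF homs(1)] homsD(1)[OF homs(2)] homsD(1)[OF nh]
    by (simp add: ShA_ShA_inv neg_neg[OF homs(3)])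
  then show ?thesis
    using tri d homsD(3)[OF ShA_inv_closed[OF homs(2)]] unfolding is_cone_def by blast
qed

end

section \<open>Metrics and good Cauchy sequences\<close>

context triangulated_category
begin

lemma metric_antimono: "metric T B \<Longrightarrow> i \<le> j \<Longrightarrow> B j \<subseteq> B i"
  by (rule lift_Suc_antimono_le) (auto simp: metric_def)

text \<open>The members of a metric contain \<^emph>\<open>all\<close> zero objects, as any zero object is an extension of the given
  one by itself.\<close>

lemma metric_zero_object:
  assumes "metric T B" and d: "zero_object T d"
  shows "d \<in> B n"
proof -
  obtain z where z: "z \<in> B n" "zero_object T z" and B: "star T (B n) (B n) = B n"
    using assms(1) unfolding metric_def by blast
  have zO: "z \<in> Obj T" and dO: "d \<in> Obj T"
    using z(2) d zero_object_Obj by auto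
  obtain b where b: "b \<in> isos T z d"
    using isos_zero_objects[OF z(2) d] .
  then have b': "b \<in> homs T z d"
    by (simp add: isos_def)
  have Z: "Zero T z z \<in> homs T z z" "Zero T z (ShO T z) \<in> homs T z (ShO T z)"
    "Zero T d z \<in> homs T d z"
    using Zero_closed zO dO ShO_closed by auto
  have "(b, Zero T d z, Zero T z (ShO T z)) \<in> Tri T"
    by (rule Tri_iso[OF TR1_Id[OF zO z(2)] Id_closed[OF zO] Z(1,2) b' Z(3,2) Id_isos[OF zO] b
          Id_isos[OF zO]])
      (simp_all add: ShA_Id zO ShO_closed Id_left[OF Z(2)] Id_right[OF Z(2)] Id_left[OF Z(1)]
        Comp_Zero_left[OF b' zO])
  then have "d \<in> star T (B n) (B n)"
    using z(1) homsD[OF b'] homsD[OF Z(3)] unfolding star_def mem_Collect_eq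
    by (intro exI[of _ b] exI[of _ "Zero T d z"] exI[of _ "Zero T z (ShO T z)"]) simp
  then show ?thesis
    by (simp add: B)
qed

lemma good_CauchyI:
  assumes "sequence T e"
    and "\<And>i j. \<exists>M. \<forall>m m' d. M \<le> m \<longrightarrow> m \<le> m' \<longrightarrow> is_cone T (trans_map T e m m') d \<longrightarrow>
      shift_pow T j d \<in> B i"
  shows "good_Cauchy T B e"
  using assms unfolding good_Cauchy_def by blast

lemma good_CauchyE:
  assumes "good_Cauchy T B e"
  obtains M where "\<And>m m' d. M \<le> m \<Longrightarrow> m \<le> m' \<Longrightarrow> is_cone T (trans_map T e m m') d \<Longrightarrow>
      shift_pow T j d \<in> B i"
proof -
  have "\<exists>M. \<forall>m m'. M \<le> m \<and> m \<le> m' \<longrightarrow>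
      (\<forall>d. is_cone T (trans_map T e m m') d \<longrightarrow> shift_pow T j d \<in> B i)"
    by (rule assms[unfolded good_Cauchy_def, THEN conjunct2, THEN spec, THEN spec])
  then obtain M where M: "\<forall>m m'. M \<le> m \<and> m \<le> m' \<longrightarrow>
      (\<forall>d. is_cone T (trans_map T e m m') d \<longrightarrow> shift_pow T j d \<in> B i)"
    by (rule exE)
  show thesis
    by (rule that[of M]) (use M in simp)
qed

lemma good_Cauchy_sequence: "good_Cauchy T B e \<Longrightarrow> sequence T e"
  by (simp add: good_Cauchy_def)

lemma improvement_subset: "improvement T B n \<subseteq> B n"
  by (cases n) auto

text \<open>Each of the \<open>n\<close> stages of the recursion that defines the improvement shifts by one step, and the
  conditions that it imposes at earlier stages concern larger members of the metric.\<close>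

lemma in_improvementI:
  assumes B: "metric T B" and "d \<in> Obj T"
    and "\<And>k. \<bar>k\<bar> \<le> int n \<Longrightarrow> shift_pow T k d \<in> B n"
  shows "d \<in> improvement T B n"
  using assms(2,3)
proof (induction n arbitrary: d)
  case 0
  then show ?case
    using 0(2)[of 0] by (simp add: shift_pow_0)
next
  case (Suc n)
  have sub: "B (Suc n) \<subseteq> B n"
    using B by (simp add: metric_def)
  have step: "shift_pow T k d \<in> improvement T B n" if "\<bar>k\<bar> \<le> 1" for k
  proof (rule Suc.IH)
    show "shift_pow T k d \<in> Obj T"
      using Suc.prems(1) by (rule shift_pow_closed)
    show "shift_pow T l (shift_pow T k d) \<in> B n" if "\<bar>l\<bar> \<le> int n" for l
      using Suc.prems(2)[of "l + k"] sub that \<open>\<bar>k\<bar> \<le> 1\<close> by (auto simp: shift_pow_add Suc.prems(1))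
  qed
  have "d \<in> ShO T ` improvement T B n"
    using step[of "- 1"] ShO_ShO_inv[OF Suc.prems(1)] by (auto simp: ShO_inv_eq_shift_pow Suc.prems(1) intro!: rev_image_eqI)
  moreover have "d \<in> ShO_inv T ` improvement T B n"
    using step[of 1] ShO_inv_ShO[OF Suc.prems(1)] by (auto simp: ShO_eq_shift_pow Suc.prems(1) intro!: rev_image_eqI)
  moreover have "d \<in> B (Suc n)"
    using Suc.prems(2)[of 0] by (simp add: shift_pow_0)
  ultimately show ?case by simp
qed

text \<open>Membership in the \<open>i\<close>-th member of the improvement follows from conditions on finitely many
  shifts of a cone, and a good Cauchy sequence for the given metric satisfies each of them from some
  index on; so it satisfies all of them from the largest of these indices on.\<close>

lemma good_Cauchy_improvement_iff:
  assumes B: "metric T B"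
  shows "good_Cauchy T (improvement T B) e \<longleftrightarrow> good_Cauchy T B e"
proof
  assume e: "good_Cauchy T (improvement T B) e"
  show "good_Cauchy T B e"
  proof (rule good_CauchyI)
    show "sequence T e"
      using e by (rule good_Cauchy_sequence)
    fix i and j :: int
    obtain M where "\<And>m m' d. M \<le> m \<Longrightarrow> m \<le> m' \<Longrightarrow> is_cone T (trans_map T e m m') d \<Longrightarrow>
        shift_pow T j d \<in> improvement T B i"
      by (rule good_CauchyE[OF e, of j i]) blast
    then show "\<exists>M. \<forall>m m' d. M \<le> m \<longrightarrow> m \<le> m' \<longrightarrow> is_cone T (trans_map T e m m') d \<longrightarrow>
        shift_pow T j d \<in> B i"
      using improvement_subset[of B i] by blast
  qed
next
  assume e: "good_Cauchy T B e"
  show "good_Cauchy T (improvement T B) e"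
  proof (rule good_CauchyI)
    show "sequence T e"
      using e by (rule good_Cauchy_sequence)
    fix i and j :: int
    have "\<exists>M. \<forall>m m' d. M \<le> m \<longrightarrow> m \<le> m' \<longrightarrow> is_cone T (trans_map T e m m') d \<longrightarrow>
        shift_pow T k d \<in> B i" for k
      by (rule good_CauchyE[OF e, of k i]) blast
    then obtain M where M: "\<And>k m m' d. M k \<le> m \<Longrightarrow> m \<le> m' \<Longrightarrow>
        is_cone T (trans_map T e m m') d \<Longrightarrow> shift_pow T k d \<in> B i"
      by metis
    \<comment> \<open>the shifts of a cone that matter are those by \<open>k + j\<close> with \<open>k\<close> between \<open>-i\<close> and \<open>i\<close>\<close>
    define N where "N = Max ((\<lambda>k. M (k + j)) ` {- int i..int i})"
    have N: "M (k + j) \<le> N" if "\<bar>k\<bar> \<le> int i" for k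
      unfolding N_def using that by (intro Max_ge finite_imageI imageI) auto
    have "shift_pow T j d \<in> improvement T B i"
      if "N \<le> m" "m \<le> m'" and d: "is_cone T (trans_map T e m m') d" for m m' d
    proof (rule in_improvementI[OF B])
      show "shift_pow T j d \<in> Obj T"
        using is_cone_Obj[OF d] by (rule shift_pow_closed)
      show "shift_pow T k (shift_pow T j d) \<in> B i" if "\<bar>k\<bar> \<le> int i" for k
        using M[OF le_trans[OF N[OF that] \<open>N \<le> m\<close>] \<open>m \<le> m'\<close> d] is_cone_Obj[OF d]
        by (simp add: shift_pow_add)
    qed
    then show "\<exists>M. \<forall>m m' d. M \<le> m \<longrightarrow> m \<le> m' \<longrightarrow> is_cone T (trans_map T e m m') d \<longrightarrow>
        shift_pow T j d \<in> improvement T B i"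
      by blast
  qed
qed

lemma good_Cauchy_ShA:
  assumes e: "good_Cauchy T B e"
  shows "good_Cauchy T B (\<lambda>n. ShA T (e n))"
proof (rule good_CauchyI)
  have seq: "sequence T e"
    using e by (rule good_Cauchy_sequence)
  then show "sequence T (\<lambda>n. ShA T (e n))"
    by (rule shift.sequence_image(1))
  fix i and j :: int
  obtain M where M: "\<And>m m' d. M \<le> m \<Longrightarrow> m \<le> m' \<Longrightarrow> is_cone T (trans_map T e m m') d \<Longrightarrow>
      shift_pow T (j + 1) d \<in> B i"
    by (rule good_CauchyE[OF e]) blast
  have "shift_pow T j d \<in> B i"
    if "M \<le> m" "m \<le> m'" and d: "is_cone T (trans_map T (\<lambda>n. ShA T (e n)) m m') d" for m m' d
  proof -
    have dO: "d \<in> Obj T"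
      using d by (rule is_cone_Obj)
    have "is_cone T (trans_map T e m m') (ShO_inv T d)"
      using is_cone_ShA_inv[OF d] shift.trans_map_image[OF seq \<open>m \<le> m'\<close>]
        homsD(1)[OF trans_map_closed[OF seq \<open>m \<le> m'\<close>]] by (simp add: ShA_inv_ShA)
    then have "shift_pow T (j + 1) (shift_pow T (- 1) d) \<in> B i"
      using M[OF that(1,2)] dO by (simp add: ShO_inv_eq_shift_pow)
    then show ?thesis
      by (simp add: shift_pow_add dO)
  qed
  then show "\<exists>M. \<forall>m m' d. M \<le> m \<longrightarrow> m \<le> m' \<longrightarrow>
      is_cone T (trans_map T (\<lambda>n. ShA T (e n)) m m') d \<longrightarrow> shift_pow T j d \<in> B i"
    by blast
qed

lemma good_Cauchy_ShA_inv:
  assumes e: "good_Cauchy T B e"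
  shows "good_Cauchy T B (\<lambda>n. ShA_inv T (e n))"
proof (rule good_CauchyI)
  have seq: "sequence T e"
    using e by (rule good_Cauchy_sequence)
  then show "sequence T (\<lambda>n. ShA_inv T (e n))"
    by (rule shift.inverse.sequence_image(1))
  fix i and j :: int
  obtain M where M: "\<And>m m' d. M \<le> m \<Longrightarrow> m \<le> m' \<Longrightarrow> is_cone T (trans_map T e m m') d \<Longrightarrow>
      shift_pow T (j - 1) d \<in> B i"
    by (rule good_CauchyE[OF e]) blast
  have "shift_pow T j d \<in> B i"
    if "M \<le> m" "m \<le> m'" and d: "is_cone T (trans_map T (\<lambda>n. ShA_inv T (e n)) m m') d" for m m' d
  proof -
    have dO: "d \<in> Obj T"
      using d by (rule is_cone_Obj)
    have "is_cone T (trans_map T e m m') (ShO T d)"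
      using is_cone_ShA[OF d] shift.inverse.trans_map_image[OF seq \<open>m \<le> m'\<close>]
        homsD(1)[OF trans_map_closed[OF seq \<open>m \<le> m'\<close>]] by (simp add: ShA_ShA_inv)
    then have "shift_pow T (j - 1) (shift_pow T 1 d) \<in> B i"
      using M[OF that(1,2)] dO by (simp add: ShO_eq_shift_pow)
    then show ?thesis
      by (simp add: shift_pow_add dO)
  qed
  then show "\<exists>M. \<forall>m m' d. M \<le> m \<longrightarrow> m \<le> m' \<longrightarrow>
      is_cone T (trans_map T (\<lambda>n. ShA_inv T (e n)) m m') d \<longrightarrow> shift_pow T j d \<in> B i"
    by blast
qed

lemma zero_sequence_good_Cauchy:
  assumes B: "metric T B" and z: "zero_object T z"
  shows "good_Cauchy T B (\<lambda>n. Id T z)"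
proof (rule good_CauchyI)
  have zO: "z \<in> Obj T"
    using z by (rule zero_object_Obj)
  show seq: "sequence T (\<lambda>n. Id T z)"
    using Id_closed[OF zO] by (simp add: sequence_def homs_def)
  have trans: "trans_map T (\<lambda>n. Id T z) m m' = Id T z" if "m \<le> m'" for m m'
    using zero_object_to_eq[OF z] trans_map_closed[OF seq that] Id_closed[OF zO] homsD[OF Id_closed[OF zO]]
    by simp
  show "\<exists>M. \<forall>m m' d. M \<le> m \<longrightarrow> m \<le> m' \<longrightarrow>
      is_cone T (trans_map T (\<lambda>n. Id T z) m m') d \<longrightarrow> shift_pow T j d \<in> B i" for i and j :: int
    using metric_zero_object[OF B shift_pow_zero_object[OF cone_Id_zero_object[OF z]]] trans by auto
qed

end

section \<open>Modules and presentations of sequential colimits\<close>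

definition vanishes :: "('o, 'a, 'm) presheaf \<Rightarrow> 'o \<Rightarrow> bool" where
  "vanishes F x \<longleftrightarrow> (\<forall>a \<in> carrier (Grp F x). a = \<one>\<^bsub>Grp F x\<^esub>)"

context additive_category
begin

lemma module_comm_group: "F \<in> modules T \<Longrightarrow> x \<in> Obj T \<Longrightarrow> comm_group (Grp F x)"
  by (simp add: modules_def)

lemma module_group: "F \<in> modules T \<Longrightarrow> x \<in> Obj T \<Longrightarrow> group (Grp F x)"
  using module_comm_group comm_group.axioms(2) by blast

lemma module_monoid: "F \<in> modules T \<Longrightarrow> x \<in> Obj T \<Longrightarrow> monoid (Grp F x)"
  using module_group group.is_monoid by blast

lemma one_in_module: "F \<in> modules T \<Longrightarrow> x \<in> Obj T \<Longrightarrow> \<one>\<^bsub>Grp F x\<^esub> \<in> carrier (Grp F x)"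
  using module_monoid monoid.one_closed by blast

lemma Act_hom:
  assumes "F \<in> modules T" "f \<in> homs T x y"
  shows "Act F f \<in> hom (Grp F y) (Grp F x)"
  using assms homsD[OF assms(2)] by (auto simp: modules_def)

lemma Act_closed:
  "F \<in> modules T \<Longrightarrow> f \<in> homs T x y \<Longrightarrow> a \<in> carrier (Grp F y) \<Longrightarrow> Act F f a \<in> carrier (Grp F x)"
  using Act_hom hom_in_carrier by metis

lemma Act_one:
  assumes "F \<in> modules T" "f \<in> homs T x y"
  shows "Act F f \<one>\<^bsub>Grp F y\<^esub> = \<one>\<^bsub>Grp F x\<^esub>"
  using hom_one[OF Act_hom[OF assms]] module_group assms(1) homs_Obj[OF assms(2)] by blast

lemma Act_Id: "F \<in> modules T \<Longrightarrow> x \<in> Obj T \<Longrightarrow> a \<in> carrier (Grp F x) \<Longrightarrow> Act F (Id T x) a = a"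
  by (simp add: modules_def)

lemma Act_Comp:
  "F \<in> modules T \<Longrightarrow> f \<in> homs T x y \<Longrightarrow> g \<in> homs T y z \<Longrightarrow> a \<in> carrier (Grp F z) \<Longrightarrow>
    Act F (g \<cdot> f) a = Act F f (Act F g a)"
  by (simp add: modules_def)

lemma Act_Add:
  "F \<in> modules T \<Longrightarrow> f \<in> homs T x y \<Longrightarrow> g \<in> homs T x y \<Longrightarrow> a \<in> carrier (Grp F y) \<Longrightarrow>
    Act F (f \<boxplus> g) a = Act F f a \<otimes>\<^bsub>Grp F x\<^esub> Act F g a"
  by (simp add: modules_def)

lemma Act_Zero:
  assumes F: "F \<in> modules T" and x: "x \<in> Obj T" and y: "y \<in> Obj T" and a: "a \<in> carrier (Grp F y)"
  shows "Act F (Zero T x y) a = \<one>\<^bsub>Grp F x\<^esub>"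
proof -
  interpret group "Grp F x"
    using F x by (rule module_group)
  note Z = Zero_closed[OF x y]
  show ?thesis
    using Act_Add[OF F Z Z a] Act_closed[OF F Z a] l_cancel_one by (simp add: Zero_Add_Zero x y)
qed

lemma nat_trans_hom: "\<eta> \<in> nat_trans T F G \<Longrightarrow> x \<in> Obj T \<Longrightarrow> \<eta> x \<in> hom (Grp F x) (Grp G x)"
  by (simp add: nat_trans_def)

lemma nat_trans_closed:
  "\<eta> \<in> nat_trans T F G \<Longrightarrow> x \<in> Obj T \<Longrightarrow> a \<in> carrier (Grp F x) \<Longrightarrow> \<eta> x a \<in> carrier (Grp G x)"
  using nat_trans_hom hom_in_carrier by metis

lemma nat_trans_natural:
  "\<eta> \<in> nat_trans T F G \<Longrightarrow> f \<in> homs T x y \<Longrightarrow> a \<in> carrier (Grp F y) \<Longrightarrow>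
    \<eta> x (Act F f a) = Act G f (\<eta> y a)"
  by (simp add: nat_trans_def)

lemma nat_trans_one:
  "\<eta> \<in> nat_trans T F G \<Longrightarrow> F \<in> modules T \<Longrightarrow> G \<in> modules T \<Longrightarrow> x \<in> Obj T \<Longrightarrow>
    \<eta> x \<one>\<^bsub>Grp F x\<^esub> = \<one>\<^bsub>Grp G x\<^esub>"
  using hom_one[OF nat_trans_hom, of \<eta> F G x] module_group[of F x] module_group[of G x] by simp

lemma nat_trans_eqI:
  assumes "\<eta> \<in> nat_trans T F G" "\<theta> \<in> nat_trans T F G"
    and "\<And>x a. x \<in> Obj T \<Longrightarrow> a \<in> carrier (Grp F x) \<Longrightarrow> \<eta> x a = \<theta> x a"
  shows "\<eta> = \<theta>"
proof (rule extensionalityI[of _ "Obj T"])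
  show "\<eta> \<in> extensional (Obj T)" "\<theta> \<in> extensional (Obj T)"
    using assms(1,2) by (simp_all add: nat_trans_def)
  fix x assume x: "x \<in> Obj T"
  show "\<eta> x = \<theta> x"
    by (rule extensionalityI[of _ "carrier (Grp F x)"]) (use assms x in \<open>simp_all add: nat_trans_def\<close>)
qed

lemma nat_isos_inverse:
  assumes "\<eta> \<in> nat_isos T F G"
  obtains \<theta> where "\<theta> \<in> nat_trans T G F"
    "\<And>x a. x \<in> Obj T \<Longrightarrow> a \<in> carrier (Grp F x) \<Longrightarrow> \<theta> x (\<eta> x a) = a"
    "\<And>x b. x \<in> Obj T \<Longrightarrow> b \<in> carrier (Grp G x) \<Longrightarrow> \<eta> x (\<theta> x b) = b"
proof -
  obtain \<theta> where \<theta>: "\<theta> \<in> nat_trans T G F"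
    and eq: "nt_comp T F \<theta> \<eta> = nt_id T F" "nt_comp T G \<eta> \<theta> = nt_id T G"
    using assms by (auto simp: nat_isos_def)
  have "\<theta> x (\<eta> x a) = a" if "x \<in> Obj T" "a \<in> carrier (Grp F x)" for x a
    using fun_cong[OF fun_cong[OF eq(1)], of x a] that by (simp add: nt_comp_def nt_id_def)
  moreover have "\<eta> x (\<theta> x b) = b" if "x \<in> Obj T" "b \<in> carrier (Grp G x)" for x b
    using fun_cong[OF fun_cong[OF eq(2)], of x b] that by (simp add: nt_comp_def nt_id_def)
  ultimately show thesis
    using \<theta> that by blast
qed

lemma nat_isosI:
  assumes F: "F \<in> modules T" and \<eta>: "\<eta> \<in> nat_trans T F G"
    and bij: "\<And>x. x \<in> Obj T \<Longrightarrow> bij_betw (\<eta> x) (carrier (Grp F x)) (carrier (Grp G x))"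
  shows "\<eta> \<in> nat_isos T F G"
proof -
  define \<theta> where
    "\<theta> = (\<lambda>x \<in> Obj T. \<lambda>b \<in> carrier (Grp G x). inv_into (carrier (Grp F x)) (\<eta> x) b)"
  have left: "\<theta> x (\<eta> x a) = a" if "x \<in> Obj T" "a \<in> carrier (Grp F x)" for x a
    using that nat_trans_closed[OF \<eta> that] bij[OF that(1)]
    by (simp add: \<theta>_def bij_betw_inv_into_left)
  have ex: "\<exists>a \<in> carrier (Grp F x). b = \<eta> x a" if "x \<in> Obj T" "b \<in> carrier (Grp G x)" for x b
    using bij[OF that(1)] that(2) by (auto simp: bij_betw_def)
  have \<theta>: "\<theta> \<in> nat_trans T G F"
    unfolding nat_trans_def
  proof (intro CollectI conjI ballI allI IntI homI)
    show "\<theta> \<in> extensional (Obj T)"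
      by (simp add: \<theta>_def)
    fix x assume x: "x \<in> Obj T"
    show "\<theta> x \<in> extensional (carrier (Grp G x))"
      using x by (simp add: \<theta>_def)
    fix b assume "b \<in> carrier (Grp G x)"
    then obtain a where a: "a \<in> carrier (Grp F x)" "b = \<eta> x a"
      using ex x by blast
    then show "\<theta> x b \<in> carrier (Grp F x)"
      by (simp add: left x)
    fix b' assume "b' \<in> carrier (Grp G x)"
    then obtain a' where a': "a' \<in> carrier (Grp F x)" "b' = \<eta> x a'"
      using ex x by blast
    have "\<eta> x (a \<otimes>\<^bsub>Grp F x\<^esub> a') = b \<otimes>\<^bsub>Grp G x\<^esub> b'"
      using hom_mult[OF nat_trans_hom[OF \<eta> x] a(1) a'(1)] a a' by simp
    then show "\<theta> x (b \<otimes>\<^bsub>Grp G x\<^esub> b') = \<theta> x b \<otimes>\<^bsub>Grp F x\<^esub> \<theta> x b'"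
      using left[OF x monoid.m_closed[OF module_monoid[OF F x] a(1) a'(1)]] a a'
      by (simp add: left x)
  next
    fix x y f b assume f: "f \<in> homs T x y" and "b \<in> carrier (Grp G y)"
    then obtain a where a: "a \<in> carrier (Grp F y)" "b = \<eta> y a"
      using ex homs_Obj(2) by blast
    show "\<theta> x (Act G f b) = Act F f (\<theta> y b)"
      using nat_trans_natural[OF \<eta> f a(1)] left[OF homs_Obj(1)[OF f] Act_closed[OF F f a(1)]]
      by (simp add: a left homs_Obj[OF f])
  qed
  have "nt_comp T F \<theta> \<eta> = nt_id T F"
    by (simp add: nt_comp_def nt_id_def left cong: restrict_cong)
  moreover have "nt_comp T G \<eta> \<theta> = nt_id T G"
    unfolding nt_comp_def nt_id_def
  proof (intro restrict_ext)
    fix x b assume x: "x \<in> Obj T" and "b \<in> carrier (Grp G x)"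
    then obtain a where "a \<in> carrier (Grp F x)" "b = \<eta> x a"
      using ex by blast
    then show "\<eta> x (\<theta> x b) = b"
      by (simp add: left x)
  qed
  ultimately show ?thesis
    using \<eta> \<theta> by (auto simp: nat_isos_def)
qed

lemma nt_zero_nat_trans:
  assumes G: "G \<in> modules T"
    and mult: "\<And>x a b. x \<in> Obj T \<Longrightarrow> a \<in> carrier (Grp F x) \<Longrightarrow> b \<in> carrier (Grp F x) \<Longrightarrow>
      a \<otimes>\<^bsub>Grp F x\<^esub> b \<in> carrier (Grp F x)"
    and act: "\<And>x y f a. f \<in> homs T x y \<Longrightarrow> a \<in> carrier (Grp F y) \<Longrightarrow> Act F f a \<in> carrier (Grp F x)"
  shows "nt_zero T F G \<in> nat_trans T F G"
  unfolding nat_trans_def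
proof (intro CollectI conjI ballI allI IntI homI)
  fix x a b assume x: "x \<in> Obj T" and "a \<in> carrier (Grp F x)" "b \<in> carrier (Grp F x)"
  then show "nt_zero T F G x (a \<otimes>\<^bsub>Grp F x\<^esub> b) = nt_zero T F G x a \<otimes>\<^bsub>Grp G x\<^esub> nt_zero T F G x b"
    using monoid.l_one[OF module_monoid[OF G x] one_in_module[OF G x]] by (simp add: nt_zero_def mult)
next
  fix x y f a assume f: "f \<in> homs T x y" and a: "a \<in> carrier (Grp F y)"
  show "nt_zero T F G x (Act F f a) = Act G f (nt_zero T F G y a)"
    using Act_one[OF G f] act[OF f a] a homs_Obj[OF f] by (simp add: nt_zero_def)
qed (simp_all add: nt_zero_def one_in_module G)

text \<open>By the Yoneda lemma, morphisms from \<open>Y(c)\<close> to \<open>F\<close> are elements of \<open>F(c)\<close>.\<close>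

lemma yoneda_perp_iff:
  assumes F: "F \<in> modules T" and c: "c \<in> Obj T"
  shows "nat_trans T (yoneda T c) F = {nt_zero T (yoneda T c) F} \<longleftrightarrow> vanishes F c"
  unfolding vanishes_def
proof
  note y = yoneda_def hom_group_def
  assume only_zero: "nat_trans T (yoneda T c) F = {nt_zero T (yoneda T c) F}"
  show "\<forall>a \<in> carrier (Grp F c). a = \<one>\<^bsub>Grp F c\<^esub>"
  proof
    fix a assume a: "a \<in> carrier (Grp F c)"
    define \<eta> where "\<eta> = (\<lambda>x \<in> Obj T. \<lambda>s \<in> homs T x c. Act F s a)"
    have "\<eta> \<in> nat_trans T (yoneda T c) F"
      unfolding nat_trans_def
    proof (intro CollectI conjI ballI allI IntI homI)
      fix x assume x: "x \<in> Obj T"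
      show "\<eta> x \<in> extensional (carrier (Grp (yoneda T c) x))"
        using x by (simp add: \<eta>_def y)
      fix s assume "s \<in> carrier (Grp (yoneda T c) x)"
      then have s: "s \<in> homs T x c"
        using x by (simp add: y)
      then show "\<eta> x s \<in> carrier (Grp F x)"
        using x Act_closed[OF F s a] by (simp add: \<eta>_def)
      fix t assume "t \<in> carrier (Grp (yoneda T c) x)"
      then have t: "t \<in> homs T x c"
        using x by (simp add: y)
      show "\<eta> x (s \<otimes>\<^bsub>Grp (yoneda T c) x\<^esub> t) = \<eta> x s \<otimes>\<^bsub>Grp F x\<^esub> \<eta> x t"
        using x s t Act_Add[OF F s t a] Add_closed[OF s t] by (simp add: \<eta>_def y)
    next
      fix x z f s assume f: "f \<in> homs T x z" and "s \<in> carrier (Grp (yoneda T c) z)"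
      then have s: "s \<in> homs T z c"
        using homs_Obj[OF f] by (simp add: y)
      show "\<eta> x (Act (yoneda T c) f s) = Act F f (\<eta> z s)"
        using Act_Comp[OF F f s a] Comp_closed[OF f s] f s homs_Obj[OF f] homsD[OF f]
        by (simp add: \<eta>_def yoneda_def)
    qed (simp add: \<eta>_def)
    then have "\<eta> c (Id T c) = nt_zero T (yoneda T c) F c (Id T c)"
      using only_zero by simp
    then show "a = \<one>\<^bsub>Grp F c\<^esub>"
      using c Id_closed[OF c] Act_Id[OF F c a] by (simp add: \<eta>_def nt_zero_def y)
  qed
next
  note y = yoneda_def hom_group_def
  assume vanish: "\<forall>a \<in> carrier (Grp F c). a = \<one>\<^bsub>Grp F c\<^esub>"
  have zero: "nt_zero T (yoneda T c) F \<in> nat_trans T (yoneda T c) F"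
  proof (rule nt_zero_nat_trans[OF F])
    show "s \<otimes>\<^bsub>Grp (yoneda T c) x\<^esub> t \<in> carrier (Grp (yoneda T c) x)"
      if "x \<in> Obj T" "s \<in> carrier (Grp (yoneda T c) x)" "t \<in> carrier (Grp (yoneda T c) x)" for x s t
      using that by (simp add: y Add_closed)
    show "Act (yoneda T c) f s \<in> carrier (Grp (yoneda T c) x)"
      if f: "f \<in> homs T x z" and s: "s \<in> carrier (Grp (yoneda T c) z)" for x z f s
      using Comp_closed[OF f, of s c] s homs_Obj[OF f] homsD[OF f] by (simp add: y)
  qed
  moreover have "\<eta> = nt_zero T (yoneda T c) F" if \<eta>: "\<eta> \<in> nat_trans T (yoneda T c) F" for \<eta>
  proof (rule nat_trans_eqI[OF \<eta> zero])
    fix x s assume x: "x \<in> Obj T" and s': "s \<in> carrier (Grp (yoneda T c) x)"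
    then have s: "s \<in> homs T x c"
      by (simp add: y)
    have Id: "Id T c \<in> carrier (Grp (yoneda T c) c)"
      using c Id_closed by (simp add: y)
    have "\<eta> x s = \<eta> x (Act (yoneda T c) s (Id T c))"
      using s Id_closed[OF c] homsD[OF s] Id_left[OF s] by (simp add: yoneda_def)
    also have "\<dots> = \<one>\<^bsub>Grp F x\<^esub>"
      using nat_trans_natural[OF \<eta> s Id] vanish nat_trans_closed[OF \<eta> c Id] Act_one[OF F s] by simp
    finally show "\<eta> x s = nt_zero T (yoneda T c) F x s"
      using x s' by (simp add: nt_zero_def)
  qed
  ultimately show "nat_trans T (yoneda T c) F = {nt_zero T (yoneda T c) F}"
    by blast
qed

end

subsection \<open>Sequential colimits of representables\<close>

context category
begin

lemma colim_rel_iff: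
  "((m, f), (n, g)) \<in> colim_rel T e x \<longleftrightarrow> f \<in> homs T x (Dom T (e m)) \<and> g \<in> homs T x (Dom T (e n)) \<and>
     (\<exists>k. m \<le> k \<and> n \<le> k \<and> trans_map T e m k \<cdot> f = trans_map T e n k \<cdot> g)"
  by (simp add: colim_rel_def)

lemma trans_map_comp_assoc:
  assumes "sequence T e" "m \<le> k" "k \<le> n" "f \<in> homs T x (Dom T (e m))"
  shows "trans_map T e m n \<cdot> f = trans_map T e k n \<cdot> (trans_map T e m k \<cdot> f)"
  using Comp_assoc[OF assms(4) trans_map_closed[OF assms(1,2)] trans_map_closed[OF assms(1,3)]]
  by (simp add: trans_map_comp assms)

lemma equiv_colim_rel:
  assumes e: "sequence T e"
  shows "equiv (SIGMA n : UNIV. homs T x (Dom T (e n))) (colim_rel T e x)"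
proof (rule equivI)
  show "colim_rel T e x \<subseteq> (SIGMA n : UNIV. homs T x (Dom T (e n))) \<times> (SIGMA n : UNIV. homs T x (Dom T (e n)))"
    by (auto simp: colim_rel_def)
  show "refl_on (SIGMA n : UNIV. homs T x (Dom T (e n))) (colim_rel T e x)"
    by (auto simp: refl_on_def colim_rel_def)
  show "sym (colim_rel T e x)"
    by (fastforce simp: sym_def colim_rel_def)
  show "trans (colim_rel T e x)"
  proof (rule transI)
    fix P Q R assume PQ: "(P, Q) \<in> colim_rel T e x" and QR: "(Q, R) \<in> colim_rel T e x"
    obtain l f m g n h where P: "P = (l, f)" and Q: "Q = (m, g)" and R: "R = (n, h)"
      by (metis surj_pair)
    obtain k where f: "f \<in> homs T x (Dom T (e l))" and g: "g \<in> homs T x (Dom T (e m))"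
      and k: "l \<le> k" "m \<le> k" "trans_map T e l k \<cdot> f = trans_map T e m k \<cdot> g"
      using PQ by (auto simp: P Q colim_rel_iff)
    obtain k' where h: "h \<in> homs T x (Dom T (e n))"
      and k': "m \<le> k'" "n \<le> k'" "trans_map T e m k' \<cdot> g = trans_map T e n k' \<cdot> h"
      using QR by (auto simp: Q R colim_rel_iff)
    let ?k = "max k k'"
    have "trans_map T e l ?k \<cdot> f = trans_map T e m ?k \<cdot> g"
      using trans_map_comp_assoc[OF e k(1) _ f, of ?k] trans_map_comp_assoc[OF e k(2) _ g, of ?k] k(3)
      by simp
    also have "\<dots> = trans_map T e n ?k \<cdot> h"
      using trans_map_comp_assoc[OF e k'(1) _ g, of ?k] trans_map_comp_assoc[OF e k'(2) _ h, of ?k] k'(3)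
      by simp
    finally show "(P, R) \<in> colim_rel T e x"
      using f h k(1) k'(2) by (auto simp: P R colim_rel_iff intro!: exI[of _ ?k])
  qed
qed

lemma colim_class_eqI:
  "sequence T e \<Longrightarrow> ((m, s), (n, t)) \<in> colim_rel T e x \<Longrightarrow>
    colim_rel T e x `` {(m, s)} = colim_rel T e x `` {(n, t)}"
  using equiv_class_eq[OF equiv_colim_rel] .

lemma colim_class_eqD:
  "sequence T e \<Longrightarrow> t \<in> homs T x (Dom T (e n)) \<Longrightarrow>
    colim_rel T e x `` {(m, s)} = colim_rel T e x `` {(n, t)} \<Longrightarrow> ((m, s), (n, t)) \<in> colim_rel T e x"
  using eq_equiv_class[OF _ equiv_colim_rel] by fastforce

end

context additive_category
begin

lemma colim_class_in_carrier:
  "s \<in> homs T x (Dom T (e n)) \<Longrightarrow> colim_rel T e x `` {(n, s)} \<in> carrier (colim_group T e x)"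
  by (auto simp: colim_group_def intro: quotientI)

lemma carrier_colim_groupE:
  assumes "P \<in> carrier (colim_group T e x)"
  obtains n s where "s \<in> homs T x (Dom T (e n))" "P = colim_rel T e x `` {(n, s)}"
  using assms by (auto simp: colim_group_def elim!: quotientE)

text \<open>All maps between colimits here (the action of an arrow, the map induced by a morphism of sequences,
  and the canonical isomorphism for the shift) are defined as a union over representatives; this lemma
  evaluates them on the class of one representative.\<close>

lemma colim_map_on_class:
  assumes d: "sequence T d" and e: "sequence T e" and s: "s \<in> homs T x (Dom T (d n))"
    and rel: "\<And>m n f g. ((m, f), (n, g)) \<in> colim_rel T d x \<Longrightarrow>
      ((m, \<phi> m f), (n, \<phi> n g)) \<in> colim_rel T e y"
  shows "(\<Union>(m, g) \<in> colim_rel T d x `` {(n, s)}. colim_rel T e y `` {(m, \<phi> m g)}) =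
    colim_rel T e y `` {(n, \<phi> n s)}"
proof -
  have "(\<lambda>(m, g). colim_rel T e y `` {(m, \<phi> m g)}) P = (\<lambda>(m, g). colim_rel T e y `` {(m, \<phi> m g)}) Q"
    if "(P, Q) \<in> colim_rel T d x" for P Q
    using colim_class_eqI[OF e rel, of "fst P" "snd P" "fst Q" "snd Q"] that by (simp add: split_beta)
  then have "(\<lambda>(m, g). colim_rel T e y `` {(m, \<phi> m g)}) respects colim_rel T d x"
    unfolding congruent_def by blast
  from UN_equiv_class[OF equiv_colim_rel[OF d] this, of "(n, s)"] show ?thesis
    using s by simp
qed

lemma colim_yoneda_Act_class:
  assumes e: "sequence T e" and f: "f \<in> homs T x y" and s: "s \<in> homs T y (Dom T (e n))"
  shows "Act (colim_yoneda T e) f (colim_rel T e y `` {(n, s)}) = colim_rel T e x `` {(n, s \<cdot> f)}"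
proof -
  have rel: "((m, g \<cdot> f), (k, h \<cdot> f)) \<in> colim_rel T e x"
    if "((m, g), (k, h)) \<in> colim_rel T e y" for m g k h
  proof -
    obtain l where g: "g \<in> homs T y (Dom T (e m))" and h: "h \<in> homs T y (Dom T (e k))"
      and l: "m \<le> l" "k \<le> l" "trans_map T e m l \<cdot> g = trans_map T e k l \<cdot> h"
      using \<open>((m, g), (k, h)) \<in> colim_rel T e y\<close> by (auto simp: colim_rel_iff)
    show ?thesis
      using Comp_assoc[OF f g trans_map_closed[OF e l(1)]] Comp_assoc[OF f h trans_map_closed[OF e l(2)]]
        l Comp_closed[OF f g] Comp_closed[OF f h] by (auto simp: colim_rel_iff intro!: exI[of _ l])
  qed
  show ?thesis
    using colim_map_on_class[OF e e s, of "\<lambda>m g. g \<cdot> f" x, OF rel] homsD[OF f]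
      colim_class_in_carrier[of s y e n] s by (simp add: colim_yoneda_def)
qed

lemma colim_map_class:
  assumes d: "sequence T d" and e: "sequence T e" and u: "seq_morphism T d e u"
    and s: "s \<in> homs T x (Dom T (d n))"
  shows "colim_map T d e u x (colim_rel T d x `` {(n, s)}) = colim_rel T e x `` {(n, u n \<cdot> s)}"
proof -
  have u_closed: "u k \<in> homs T (Dom T (d k)) (Dom T (e k))" for k
    using u by (simp add: seq_morphism_def)
  have rel: "((m, u m \<cdot> g), (k, u k \<cdot> h)) \<in> colim_rel T e x"
    if "((m, g), (k, h)) \<in> colim_rel T d x" for m g k h
  proof -
    obtain l where g: "g \<in> homs T x (Dom T (d m))" and h: "h \<in> homs T x (Dom T (d k))"
      and l: "m \<le> l" "k \<le> l" "trans_map T d m l \<cdot> g = trans_map T d k l \<cdot> h"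
      using \<open>((m, g), (k, h)) \<in> colim_rel T d x\<close> by (auto simp: colim_rel_iff)
    have eq: "trans_map T e i l \<cdot> (u i \<cdot> f) = u l \<cdot> (trans_map T d i l \<cdot> f)"
      if "i \<le> l" "f \<in> homs T x (Dom T (d i))" for i f
      using Comp_assoc[OF that(2) u_closed trans_map_closed[OF e that(1)]]
        Comp_assoc[OF that(2) trans_map_closed[OF d that(1)] u_closed]
        seq_morphism_trans_map[OF d e u that(1)] by simp
    show ?thesis
      using eq[OF l(1) g] eq[OF l(2) h] l Comp_closed[OF g u_closed] Comp_closed[OF h u_closed]
      by (auto simp: colim_rel_iff intro!: exI[of _ l])
  qed
  show ?thesis
    using colim_map_on_class[OF d e s, of "\<lambda>m g. u m \<cdot> g" x, OF rel] homs_Obj(1)[OF s]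
      colim_class_in_carrier[of s x d n] s by (simp add: colim_map_def)
qed

end

text \<open>A family of elements of the groups \<open>F(E\<^sub>n)\<close> that exhibits \<open>F\<close> as the colimit of \<open>Y(e)\<close>.  By the
  Yoneda lemma such elements are the components \<open>Y(E\<^sub>n) \<rightarrow> F\<close> of a cocone; the last two conditions say
  that every element of \<open>F\<close> comes from a finite stage and that two representatives of an element become
  equal at a later stage.\<close>

definition colim_presentation :: "('o, 'a, 'z) preadd_data_scheme \<Rightarrow> (nat \<Rightarrow> 'a) \<Rightarrow>
    ('o, 'a, 'm) presheaf \<Rightarrow> (nat \<Rightarrow> 'm) \<Rightarrow> bool" where
  "colim_presentation T e F \<xi> \<longleftrightarrow>
     (\<forall>n. \<xi> n \<in> carrier (Grp F (Dom T (e n))) \<and> Act F (e n) (\<xi> (Suc n)) = \<xi> n) \<and>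
     (\<forall>x \<in> Obj T. \<forall>a \<in> carrier (Grp F x). \<exists>n. \<exists>s \<in> homs T x (Dom T (e n)). a = Act F s (\<xi> n)) \<and>
     (\<forall>x m n s t. s \<in> homs T x (Dom T (e m)) \<longrightarrow> t \<in> homs T x (Dom T (e n)) \<longrightarrow>
        Act F s (\<xi> m) = Act F t (\<xi> n) \<longrightarrow> ((m, s), (n, t)) \<in> colim_rel T e x)"

context additive_category
begin

lemma colim_presentation_closed:
  "colim_presentation T e F \<xi> \<Longrightarrow> \<xi> n \<in> carrier (Grp F (Dom T (e n)))"
  by (simp add: colim_presentation_def)

lemma colim_presentation_E:
  assumes "colim_presentation T e F \<xi>" "x \<in> Obj T" "a \<in> carrier (Grp F x)"
  obtains n s where "s \<in> homs T x (Dom T (e n))" "a = Act F s (\<xi> n)"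
  using assms unfolding colim_presentation_def by meson

lemma colim_presentation_rel:
  "colim_presentation T e F \<xi> \<Longrightarrow> s \<in> homs T x (Dom T (e m)) \<Longrightarrow> t \<in> homs T x (Dom T (e n)) \<Longrightarrow>
    Act F s (\<xi> m) = Act F t (\<xi> n) \<Longrightarrow> ((m, s), (n, t)) \<in> colim_rel T e x"
  by (simp add: colim_presentation_def)

lemma colim_presentation_trans_map:
  assumes F: "F \<in> modules T" and e: "sequence T e" and pres: "colim_presentation T e F \<xi>" and "m \<le> n"
  shows "Act F (trans_map T e m n) (\<xi> n) = \<xi> m"
  using \<open>m \<le> n\<close>
proof (induction n rule: dec_induct)
  case base
  then show ?case
    using Act_Id[OF F sequence_Obj[OF e] colim_presentation_closed[OF pres]] by (simp add: trans_map_refl)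
next
  case (step n)
  have "Act F (e n) (\<xi> (Suc n)) = \<xi> n"
    using pres by (simp add: colim_presentation_def)
  then show ?case
    using step Act_Comp[OF F trans_map_closed[OF e step(1)] sequence_homs[OF e]
        colim_presentation_closed[OF pres]] by (simp add: trans_map_Suc)
qed

lemma colim_presentation_advance:
  assumes F: "F \<in> modules T" and e: "sequence T e" and pres: "colim_presentation T e F \<xi>" and "m \<le> n"
    and s: "s \<in> homs T x (Dom T (e m))"
  shows "Act F (trans_map T e m n \<cdot> s) (\<xi> n) = Act F s (\<xi> m)"
  using Act_Comp[OF F s trans_map_closed[OF e \<open>m \<le> n\<close>] colim_presentation_closed[OF pres]]
    colim_presentation_trans_map[OF F e pres \<open>m \<le> n\<close>] by simp

lemma colim_presentation_rel_iff:
  assumes F: "F \<in> modules T" and e: "sequence T e" and pres: "colim_presentation T e F \<xi>"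
    and s: "s \<in> homs T x (Dom T (e m))" and t: "t \<in> homs T x (Dom T (e n))"
  shows "((m, s), (n, t)) \<in> colim_rel T e x \<longleftrightarrow> Act F s (\<xi> m) = Act F t (\<xi> n)"
proof
  assume "((m, s), (n, t)) \<in> colim_rel T e x"
  then obtain k where "m \<le> k" "n \<le> k" "trans_map T e m k \<cdot> s = trans_map T e n k \<cdot> t"
    by (auto simp: colim_rel_iff)
  then show "Act F s (\<xi> m) = Act F t (\<xi> n)"
    using colim_presentation_advance[OF F e pres _ s] colim_presentation_advance[OF F e pres _ t] by metis
qed (rule colim_presentation_rel[OF pres s t])

lemma colim_presentation_vanish:
  assumes F: "F \<in> modules T" and e: "sequence T e" and pres: "colim_presentation T e F \<xi>"
    and s: "s \<in> homs T x (Dom T (e n))" and zero: "Act F s (\<xi> n) = \<one>\<^bsub>Grp F x\<^esub>"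
  obtains k where "n \<le> k" "trans_map T e n k \<cdot> s = Zero T x (Dom T (e k))"
proof -
  have x: "x \<in> Obj T"
    using s by (rule homs_Obj)
  note E = sequence_Obj[OF e]
  have "Act F s (\<xi> n) = Act F (Zero T x (Dom T (e n))) (\<xi> n)"
    using zero Act_Zero[OF F x E colim_presentation_closed[OF pres]] by simp
  then have "((n, s), (n, Zero T x (Dom T (e n)))) \<in> colim_rel T e x"
    by (rule colim_presentation_rel[OF pres s Zero_closed[OF x E]])
  then obtain k where "n \<le> k" "trans_map T e n k \<cdot> s = trans_map T e n k \<cdot> Zero T x (Dom T (e n))"
    by (auto simp: colim_rel_iff)
  then show thesis
    using that Comp_Zero_right[OF trans_map_closed[OF e] x] by simp
qed

text \<open>The elements are the preimages of the classes of the identities of the objects \<open>E\<^sub>n\<close>.\<close>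

lemma colim_presentation_of_iso:
  assumes F: "F \<in> modules T" and e: "sequence T e" and \<phi>: "\<phi> \<in> nat_isos T F (colim_yoneda T e)"
  obtains \<xi> where "colim_presentation T e F \<xi>"
    "\<And>n x s. s \<in> homs T x (Dom T (e n)) \<Longrightarrow> \<phi> x (Act F s (\<xi> n)) = colim_rel T e x `` {(n, s)}"
proof -
  obtain \<theta> where \<theta>: "\<theta> \<in> nat_trans T (colim_yoneda T e) F"
    and \<theta>\<phi>: "\<And>x a. x \<in> Obj T \<Longrightarrow> a \<in> carrier (Grp F x) \<Longrightarrow> \<theta> x (\<phi> x a) = a"
    and \<phi>\<theta>: "\<And>x P. x \<in> Obj T \<Longrightarrow> P \<in> carrier (Grp (colim_yoneda T e) x) \<Longrightarrow> \<phi> x (\<theta> x P) = P"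
    using nat_isos_inverse[OF \<phi>] by blast
  have \<phi>': "\<phi> \<in> nat_trans T F (colim_yoneda T e)"
    using \<phi> by (simp add: nat_isos_def)
  have carrier: "carrier (Grp (colim_yoneda T e) x) = carrier (colim_group T e x)" if "x \<in> Obj T" for x
    using that by (simp add: colim_yoneda_def)
  note E = sequence_Obj[OF e]
  note IdE = Id_closed[OF E]
  define \<xi> where "\<xi> n = \<theta> (Dom T (e n)) (colim_rel T e (Dom T (e n)) `` {(n, Id T (Dom T (e n)))})" for n
  have IdP: "colim_rel T e (Dom T (e n)) `` {(n, Id T (Dom T (e n)))} \<in>
      carrier (Grp (colim_yoneda T e) (Dom T (e n)))" for n
    using colim_class_in_carrier[OF IdE] carrier[OF E] by simp
  have \<xi>: "\<xi> n \<in> carrier (Grp F (Dom T (e n)))" for n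
    unfolding \<xi>_def by (rule nat_trans_closed[OF \<theta> E IdP])
  have \<phi>_Act: "\<phi> x (Act F s (\<xi> n)) = colim_rel T e x `` {(n, s)}" if s: "s \<in> homs T x (Dom T (e n))" for x s n
    using nat_trans_natural[OF \<phi>' s \<xi>] \<phi>\<theta>[OF E IdP] colim_yoneda_Act_class[OF e s IdE] Id_left[OF s]
    by (simp add: \<xi>_def)
  have inj: "a = b" if "\<phi> x a = \<phi> x b" "x \<in> Obj T" "a \<in> carrier (Grp F x)" "b \<in> carrier (Grp F x)" for x a b
    using \<theta>\<phi> that by metis
  have "colim_presentation T e F \<xi>"
    unfolding colim_presentation_def
  proof (intro conjI allI ballI impI)
    fix n
    have en: "e n \<in> homs T (Dom T (e n)) (Dom T (e (Suc n)))"
      using e by (rule sequence_homs)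
    have "((Suc n, e n), (n, Id T (Dom T (e n)))) \<in> colim_rel T e (Dom T (e n))"
      using en IdE Id_left[OF en] Id_right[OF en]
      by (auto simp: colim_rel_iff trans_map_Suc trans_map_refl intro!: exI[of _ "Suc n"])
    then have "\<phi> (Dom T (e n)) (Act F (e n) (\<xi> (Suc n))) = \<phi> (Dom T (e n)) (Act F (Id T (Dom T (e n))) (\<xi> n))"
      using \<phi>_Act[OF en] \<phi>_Act[OF IdE] colim_class_eqI[OF e] by simp
    then show "Act F (e n) (\<xi> (Suc n)) = \<xi> n"
      using inj[OF _ E Act_closed[OF F en \<xi>] \<xi>] Act_Id[OF F E \<xi>] by simp
  next
    fix x a assume x: "x \<in> Obj T" and a: "a \<in> carrier (Grp F x)"
    have "\<phi> x a \<in> carrier (colim_group T e x)"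
      using nat_trans_closed[OF \<phi>' x a] carrier[OF x] by simp
    then obtain n s where s: "s \<in> homs T x (Dom T (e n))" "\<phi> x a = colim_rel T e x `` {(n, s)}"
      by (rule carrier_colim_groupE)
    have "a = Act F s (\<xi> n)"
      using inj[OF _ x a Act_closed[OF F s(1) \<xi>]] \<phi>_Act[OF s(1)] s(2) by simp
    then show "\<exists>n. \<exists>s \<in> homs T x (Dom T (e n)). a = Act F s (\<xi> n)"
      using s(1) by blast
  next
    fix x m n s t
    assume s: "s \<in> homs T x (Dom T (e m))" and t: "t \<in> homs T x (Dom T (e n))"
      and "Act F s (\<xi> m) = Act F t (\<xi> n)"
    then have "colim_rel T e x `` {(m, s)} = colim_rel T e x `` {(n, t)}"
      using \<phi>_Act[OF s] \<phi>_Act[OF t] by simp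
    then show "((m, s), (n, t)) \<in> colim_rel T e x"
      by (rule colim_class_eqD[OF e t])
  qed (rule \<xi>)
  then show thesis
    using \<phi>_Act by (rule that)
qed

lemma iso_of_colim_presentation:
  assumes F: "F \<in> modules T" and e: "sequence T e" and pres: "colim_presentation T e F \<xi>"
  shows "nat_isos T F (colim_yoneda T e) \<noteq> {}"
proof -
  \<comment> \<open>the class in the colimit that corresponds to \<open>a\<close> consists of all representatives of \<open>a\<close>\<close>
  define \<phi> where "\<phi> = (\<lambda>x \<in> Obj T. \<lambda>a \<in> carrier (Grp F x).
    {(n, s). s \<in> homs T x (Dom T (e n)) \<and> Act F s (\<xi> n) = a})"
  note E = sequence_Obj[OF e] and \<xi> = colim_presentation_closed[OF pres]
  have \<phi>_class: "\<phi> x a = colim_rel T e x `` {(n, s)}"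
    if s: "s \<in> homs T x (Dom T (e n))" and a: "a = Act F s (\<xi> n)" for x a n s
  proof -
    have "((n, s), (m, t)) \<in> colim_rel T e x \<longleftrightarrow> t \<in> homs T x (Dom T (e m)) \<and> Act F t (\<xi> m) = a" for m t
      using colim_presentation_rel_iff[OF F e pres s, of t m] a by (auto simp: colim_rel_iff)
    then show ?thesis
      using Act_closed[OF F s \<xi>] homs_Obj(1)[OF s] by (auto simp: \<phi>_def a)
  qed
  have grp: "Grp (colim_yoneda T e) x = colim_group T e x" if "x \<in> Obj T" for x
    using that by (simp add: colim_yoneda_def)
  have "\<phi> \<in> nat_trans T F (colim_yoneda T e)"
    unfolding nat_trans_def
  proof (intro CollectI conjI ballI allI IntI homI)
    fix x assume x: "x \<in> Obj T"
    show "\<phi> x \<in> extensional (carrier (Grp F x))"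
      using x by (simp add: \<phi>_def)
    fix a assume a: "a \<in> carrier (Grp F x)"
    obtain n s where s: "s \<in> homs T x (Dom T (e n))" "a = Act F s (\<xi> n)"
      using colim_presentation_E[OF pres x a] .
    show "\<phi> x a \<in> carrier (Grp (colim_yoneda T e) x)"
      using \<phi>_class[OF s] colim_class_in_carrier[of s x e n] s(1) grp[OF x] by simp
    fix b assume b: "b \<in> carrier (Grp F x)"
    obtain m t where t: "t \<in> homs T x (Dom T (e m))" "b = Act F t (\<xi> m)"
      using colim_presentation_E[OF pres x b] .
    have sum: "colim_rel T e x `` {(max k l, (trans_map T e k (max k l) \<cdot> f) \<boxplus> (trans_map T e l (max k l) \<cdot> g))}
        = \<phi> x (a \<otimes>\<^bsub>Grp F x\<^esub> b)" if "(k, f) \<in> \<phi> x a" "(l, g) \<in> \<phi> x b" for k f l g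
    proof -
      let ?m = "max k l"
      have f: "f \<in> homs T x (Dom T (e k))" "Act F f (\<xi> k) = a"
        and g: "g \<in> homs T x (Dom T (e l))" "Act F g (\<xi> l) = b"
        using that x a b by (simp_all add: \<phi>_def)
      have f': "trans_map T e k ?m \<cdot> f \<in> homs T x (Dom T (e ?m))"
        and g': "trans_map T e l ?m \<cdot> g \<in> homs T x (Dom T (e ?m))"
        using Comp_closed[OF f(1) trans_map_closed[OF e]] Comp_closed[OF g(1) trans_map_closed[OF e]] by simp_all
      have "Act F ((trans_map T e k ?m \<cdot> f) \<boxplus> (trans_map T e l ?m \<cdot> g)) (\<xi> ?m) = a \<otimes>\<^bsub>Grp F x\<^esub> b"
        using Act_Add[OF F f' g' \<xi>] colim_presentation_advance[OF F e pres _ f(1), of ?m]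
          colim_presentation_advance[OF F e pres _ g(1), of ?m] f g by simp
      then show ?thesis
        using \<phi>_class[OF Add_closed[OF f' g']] by simp
    qed
    have nonempty: "(n, s) \<in> \<phi> x a" "(m, t) \<in> \<phi> x b"
      using s t x a b by (simp_all add: \<phi>_def)
    have "\<phi> x a \<otimes>\<^bsub>colim_group T e x\<^esub> \<phi> x b = (\<Union>(k, f) \<in> \<phi> x a. \<Union>(l, g) \<in> \<phi> x b. \<phi> x (a \<otimes>\<^bsub>Grp F x\<^esub> b))"
      unfolding colim_group_def by (simp add: sum split_beta cong: SUP_cong_simp)
    also have "\<dots> = \<phi> x (a \<otimes>\<^bsub>Grp F x\<^esub> b)"
      using nonempty by auto
    finally show "\<phi> x (a \<otimes>\<^bsub>Grp F x\<^esub> b) = \<phi> x a \<otimes>\<^bsub>Grp (colim_yoneda T e) x\<^esub> \<phi> x b"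
      by (simp add: grp x)
  next
    fix x y f a assume f: "f \<in> homs T x y" and a: "a \<in> carrier (Grp F y)"
    obtain n s where s: "s \<in> homs T y (Dom T (e n))" "a = Act F s (\<xi> n)"
      using colim_presentation_E[OF pres homs_Obj(2)[OF f] a] .
    show "\<phi> x (Act F f a) = Act (colim_yoneda T e) f (\<phi> y a)"
      using \<phi>_class[OF Comp_closed[OF f s(1)]] Act_Comp[OF F f s(1) \<xi>] \<phi>_class[OF s]
        colim_yoneda_Act_class[OF e f s(1)] s(2) by simp
  qed (simp add: \<phi>_def)
  moreover have "bij_betw (\<phi> x) (carrier (Grp F x)) (carrier (Grp (colim_yoneda T e) x))"
    if x: "x \<in> Obj T" for x
    unfolding bij_betw_def grp[OF x]
  proof (intro conjI equalityI subsetI inj_onI)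
    fix a b assume a: "a \<in> carrier (Grp F x)" and b: "b \<in> carrier (Grp F x)" and eq: "\<phi> x a = \<phi> x b"
    obtain n s where s: "s \<in> homs T x (Dom T (e n))" "a = Act F s (\<xi> n)"
      using colim_presentation_E[OF pres x a] .
    then have "(n, s) \<in> \<phi> x b"
      using x a unfolding eq[symmetric] by (simp add: \<phi>_def)
    then show "a = b"
      using s x b by (simp add: \<phi>_def)
  next
    fix P assume "P \<in> \<phi> x ` carrier (Grp F x)"
    then obtain a where a: "a \<in> carrier (Grp F x)" "P = \<phi> x a"
      by blast
    obtain n s where s: "s \<in> homs T x (Dom T (e n))" "a = Act F s (\<xi> n)"
      using colim_presentation_E[OF pres x a(1)] .
    show "P \<in> carrier (colim_group T e x)"
      using \<phi>_class[OF s] colim_class_in_carrier[of s x e n] s(1) a(2) by simp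
  next
    fix P assume "P \<in> carrier (colim_group T e x)"
    then obtain n s where s: "s \<in> homs T x (Dom T (e n))" "P = colim_rel T e x `` {(n, s)}"
      by (rule carrier_colim_groupE)
    show "P \<in> \<phi> x ` carrier (Grp F x)"
      using \<phi>_class[OF s(1) refl] s(2) Act_closed[OF F s(1) \<xi>] by blast
  qed
  ultimately have "\<phi> \<in> nat_isos T F (colim_yoneda T e)"
    by (rule nat_isosI[OF F])
  then show ?thesis by blast
qed

end

section \<open>Transport along the shift\<close>

text \<open>For the inverse shift this is the shift of modules; for the shift itself it is the inverse of the
  shift of modules.\<close>

definition pullback_mod :: "('o, 'a, 'z) preadd_data_scheme \<Rightarrow> ('o \<Rightarrow> 'o) \<Rightarrow> ('a \<Rightarrow> 'a) \<Rightarrow>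
    ('o, 'a, 'm) presheaf \<Rightarrow> ('o, 'a, 'm) presheaf" where
  "pullback_mod T FO FA F = \<lparr>
     Grp = (\<lambda>x \<in> Obj T. Grp F (FO x)),
     Act = (\<lambda>f \<in> Arr T. Act F (FA f))\<rparr>"

lemma pullback_mod_simps:
  "x \<in> Obj T \<Longrightarrow> Grp (pullback_mod T FO FA F) x = Grp F (FO x)"
  "f \<in> Arr T \<Longrightarrow> Act (pullback_mod T FO FA F) f = Act F (FA f)"
  by (simp_all add: pullback_mod_def)

lemma shift_mod_eq_pullback: "shift_mod T F = pullback_mod T (ShO_inv T) (ShA_inv T) F"
  by (simp add: shift_mod_def pullback_mod_def)

context additive_endofunctor
begin

lemma pullback_mod_in_modules:
  assumes F: "F \<in> modules T"
  shows "pullback_mod T FO FA F \<in> modules T"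
proof -
  let ?P = "pullback_mod T FO FA F"
  have "Grp ?P \<in> extensional (Obj T)" "Act ?P \<in> extensional (Arr T)"
    by (simp_all add: pullback_mod_def)
  moreover have "comm_group (Grp ?P x)" if "x \<in> Obj T" for x
    using that module_comm_group[OF F FO_closed] by (simp add: pullback_mod_simps)
  moreover have "Act ?P f \<in> hom (Grp ?P (Cod T f)) (Grp ?P (Dom T f)) \<inter> extensional (carrier (Grp ?P (Cod T f)))"
    if f: "f \<in> Arr T" for f
    using FA_Arr[OF f] F f Dom_closed Cod_closed by (simp add: pullback_mod_simps modules_def) metis
  moreover have "Act ?P (Id T x) a = a" if x: "x \<in> Obj T" and a: "a \<in> carrier (Grp ?P x)" for x a
    using Act_Id[OF F FO_closed[OF x]] a x homsD(1)[OF Id_closed[OF x]] by (simp add: pullback_mod_simps FA_Id)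
  moreover have "Act ?P (g \<cdot> f) a = Act ?P f (Act ?P g a)"
    if f: "f \<in> homs T x y" and g: "g \<in> homs T y z" and a: "a \<in> carrier (Grp ?P z)" for x y z f g a
    using Act_Comp[OF F FA_closed[OF f] FA_closed[OF g]] a homs_Obj[OF g] homsD(1)[OF f] homsD(1)[OF g]
      homsD(1)[OF Comp_closed[OF f g]] by (simp add: pullback_mod_simps FA_Comp[OF f g])
  moreover have "Act ?P (f \<boxplus> g) a = Act ?P f a \<otimes>\<^bsub>Grp ?P x\<^esub> Act ?P g a"
    if f: "f \<in> homs T x y" and g: "g \<in> homs T x y" and a: "a \<in> carrier (Grp ?P y)" for x y f g a
    using Act_Add[OF F FA_closed[OF f] FA_closed[OF g]] a homs_Obj[OF g] homsD(1)[OF f] homsD(1)[OF g]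
      homsD(1)[OF Add_closed[OF f g]] by (simp add: pullback_mod_simps FA_Add[OF f g])
  ultimately show ?thesis
    unfolding modules_def by blast
qed

lemma pullback_nat_trans:
  assumes u: "u \<in> nat_trans T F G"
  shows "(\<lambda>x \<in> Obj T. u (FO x)) \<in> nat_trans T (pullback_mod T FO FA F) (pullback_mod T FO FA G)"
  unfolding nat_trans_def
proof (intro CollectI conjI ballI allI)
  fix x assume x: "x \<in> Obj T"
  show "(\<lambda>x \<in> Obj T. u (FO x)) x \<in> hom (Grp (pullback_mod T FO FA F) x) (Grp (pullback_mod T FO FA G) x) \<inter>
      extensional (carrier (Grp (pullback_mod T FO FA F) x))"
    using u x FO_closed[OF x] by (simp add: pullback_mod_simps nat_trans_def)
next
  fix x y f a assume f: "f \<in> homs T x y" and "a \<in> carrier (Grp (pullback_mod T FO FA F) y)"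
  then show "(\<lambda>x \<in> Obj T. u (FO x)) x (Act (pullback_mod T FO FA F) f a) =
      Act (pullback_mod T FO FA G) f ((\<lambda>x \<in> Obj T. u (FO x)) y a)"
    using nat_trans_natural[OF u FA_closed[OF f]] homs_Obj[OF f] homsD(1)[OF f]
    by (simp add: pullback_mod_simps)
qed simp

lemma colim_rel_image:
  assumes e: "sequence T e" and rel: "((m, s), (n, t)) \<in> colim_rel T e x"
  shows "((m, FA s), (n, FA t)) \<in> colim_rel T (\<lambda>n. FA (e n)) (FO x)"
proof -
  obtain k where s: "s \<in> homs T x (Dom T (e m))" and t: "t \<in> homs T x (Dom T (e n))"
    and k: "m \<le> k" "n \<le> k" "trans_map T e m k \<cdot> s = trans_map T e n k \<cdot> t"
    using rel by (auto simp: colim_rel_iff)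
  show ?thesis
    using FA_Comp[OF s trans_map_closed[OF e k(1)]] FA_Comp[OF t trans_map_closed[OF e k(2)]] k
      FA_closed[OF s] FA_closed[OF t]
    by (auto simp: colim_rel_iff sequence_image(2)[OF e] trans_map_image[OF e] intro!: exI[of _ k])
qed

end

context additive_automorphism
begin

lemma pullback_mod_cancel:
  assumes F: "F \<in> modules T"
  shows "pullback_mod T GO GA (pullback_mod T FO FA F) = F"
proof (rule presheaf.equality)
  show "Grp (pullback_mod T GO GA (pullback_mod T FO FA F)) = Grp F"
    by (rule extensionalityI[of _ "Obj T"])
      (use F in \<open>simp_all add: pullback_mod_def modules_def inverse.FO_closed FO_GO\<close>)
  show "Act (pullback_mod T GO GA (pullback_mod T FO FA F)) = Act F"
    by (rule extensionalityI[of _ "Arr T"])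
      (use F in \<open>simp_all add: pullback_mod_def modules_def inverse.FA_Arr FA_GA\<close>)
qed simp

text \<open>The elements \<open>\<xi>\<^sub>n\<close> need not be changed: the pullback along the inverse automorphism takes at the image
  of \<open>E\<^sub>n\<close> the value that \<open>F\<close> takes at \<open>E\<^sub>n\<close>.\<close>

lemma pullback_colim_presentation:
  assumes e: "sequence T e" and pres: "colim_presentation T e F \<xi>"
  shows "colim_presentation T (\<lambda>n. FA (e n)) (pullback_mod T GO GA F) \<xi>"
  unfolding colim_presentation_def sequence_image(2)[OF e]
proof (intro conjI allI ballI impI)
  note E = sequence_Obj[OF e]
  have e_Arr: "e n \<in> Arr T" for n
    using homsD(1)[OF sequence_homs[OF e]] .
  show "\<xi> n \<in> carrier (Grp (pullback_mod T GO GA F) (FO (Dom T (e n))))" for n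
    using colim_presentation_closed[OF pres, of n] by (simp add: pullback_mod_simps FO_closed E GO_FO)
  show "Act (pullback_mod T GO GA F) (FA (e n)) (\<xi> (Suc n)) = \<xi> n" for n
    using pres FA_Arr[OF e_Arr] by (simp add: pullback_mod_simps GA_FA e_Arr colim_presentation_def)
  show "\<exists>n. \<exists>s \<in> homs T x (FO (Dom T (e n))). a = Act (pullback_mod T GO GA F) s (\<xi> n)"
    if x: "x \<in> Obj T" and "a \<in> carrier (Grp (pullback_mod T GO GA F) x)" for x a
  proof -
    have a: "a \<in> carrier (Grp F (GO x))"
      using that by (simp add: pullback_mod_simps)
    obtain n s where s: "s \<in> homs T (GO x) (Dom T (e n))" "a = Act F s (\<xi> n)"
      using colim_presentation_E[OF pres inverse.FO_closed[OF x] a] .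
    have "FA s \<in> homs T x (FO (Dom T (e n)))"
      using FA_closed[OF s(1)] by (simp add: FO_GO x)
    moreover have "a = Act (pullback_mod T GO GA F) (FA s) (\<xi> n)"
      using s(2) homsD(1)[OF s(1)] FA_Arr by (simp add: pullback_mod_simps GA_FA)
    ultimately show ?thesis by blast
  qed
  show "((m, s), (n, t)) \<in> colim_rel T (\<lambda>n. FA (e n)) x"
    if s: "s \<in> homs T x (FO (Dom T (e m)))" and t: "t \<in> homs T x (FO (Dom T (e n)))"
      and eq: "Act (pullback_mod T GO GA F) s (\<xi> m) = Act (pullback_mod T GO GA F) t (\<xi> n)" for x m n s t
  proof -
    have "GA s \<in> homs T (GO x) (Dom T (e m))" "GA t \<in> homs T (GO x) (Dom T (e n))"
      using inverse.FA_closed[OF s] inverse.FA_closed[OF t] by (simp_all add: GO_FO E)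
    moreover have "Act F (GA s) (\<xi> m) = Act F (GA t) (\<xi> n)"
      using eq homsD(1)[OF s] homsD(1)[OF t] by (simp add: pullback_mod_simps)
    ultimately have "((m, GA s), (n, GA t)) \<in> colim_rel T e (GO x)"
      by (rule colim_presentation_rel[OF pres])
    then show ?thesis
      using colim_rel_image[OF e] homsD(1)[OF s] homsD(1)[OF t] homs_Obj(1)[OF s]
      by (metis FA_GA FO_GO)
  qed
qed

end

section \<open>Exactness of colimits of triangles\<close>

context additive_category
begin

text \<open>Exactness passes to the colimit: a representative of an element that is killed by \<open>v\<close> is killed by
  \<open>\<beta>\<close> at some later stage, and at that stage it lifts along \<open>\<alpha>\<close>.\<close>

lemma vanishes_of_exact_sequence:
  assumes F: "F \<in> modules T" and G: "G \<in> modules T" and H: "H \<in> modules T"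
    and u: "u \<in> nat_trans T F G" and v: "v \<in> nat_trans T G H"
    and seq: "sequence T p" "sequence T q" "sequence T r"
    and \<alpha>: "seq_morphism T p q \<alpha>" and \<beta>: "seq_morphism T q r \<beta>"
    and presF: "colim_presentation T p F \<xi>" and presG: "colim_presentation T q G \<eta>"
    and presH: "colim_presentation T r H \<zeta>"
    and u_pres: "\<And>n. u (Dom T (p n)) (\<xi> n) = Act G (\<alpha> n) (\<eta> n)"
    and v_pres: "\<And>n. v (Dom T (q n)) (\<eta> n) = Act H (\<beta> n) (\<zeta> n)"
    and exact: "\<And>n c s. s \<in> homs T c (Dom T (q n)) \<Longrightarrow> \<beta> n \<cdot> s = Zero T c (Dom T (r n)) \<Longrightarrow>
      \<exists>t \<in> homs T c (Dom T (p n)). \<alpha> n \<cdot> t = s"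
    and c: "c \<in> Obj T" and vanish: "vanishes F c" "vanishes H c"
  shows "vanishes G c"
  unfolding vanishes_def
proof
  note \<xi> = colim_presentation_closed[OF presF] and \<eta> = colim_presentation_closed[OF presG]
    and \<zeta> = colim_presentation_closed[OF presH]
  have \<alpha>_closed: "\<alpha> n \<in> homs T (Dom T (p n)) (Dom T (q n))"
    and \<beta>_closed: "\<beta> n \<in> homs T (Dom T (q n)) (Dom T (r n))" for n
    using \<alpha> \<beta> by (simp_all add: seq_morphism_def)
  fix b assume b: "b \<in> carrier (Grp G c)"
  obtain n s where s: "s \<in> homs T c (Dom T (q n))" and bs: "b = Act G s (\<eta> n)"
    using colim_presentation_E[OF presG c b] .
  have "Act H (\<beta> n \<cdot> s) (\<zeta> n) = v c b"
    using Act_Comp[OF H s \<beta>_closed \<zeta>] nat_trans_natural[OF v s \<eta>] v_pres bs by simp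
  also have "\<dots> = \<one>\<^bsub>Grp H c\<^esub>"
    using nat_trans_closed[OF v c b] vanish(2) by (simp add: vanishes_def)
  finally obtain k where k: "n \<le> k"
    and zero: "trans_map T r n k \<cdot> (\<beta> n \<cdot> s) = Zero T c (Dom T (r k))"
    using colim_presentation_vanish[OF H seq(3) presH Comp_closed[OF s \<beta>_closed]] by blast
  note tq = trans_map_closed[OF seq(2) k] and tr = trans_map_closed[OF seq(3) k]
  let ?s = "trans_map T q n k \<cdot> s"
  have s': "?s \<in> homs T c (Dom T (q k))"
    by (rule Comp_closed[OF s tq])
  have "\<beta> k \<cdot> ?s = Zero T c (Dom T (r k))"
    using Comp_assoc[OF s tq \<beta>_closed] Comp_assoc[OF s \<beta>_closed tr] zero
      seq_morphism_trans_map[OF seq(2,3) \<beta> k] by simp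
  then obtain t where t: "t \<in> homs T c (Dom T (p k))" and \<alpha>t: "\<alpha> k \<cdot> t = ?s"
    using exact[OF s'] by blast
  have "b = Act G (\<alpha> k \<cdot> t) (\<eta> k)"
    using colim_presentation_advance[OF G seq(2) presG k s] bs \<alpha>t by simp
  also have "\<dots> = u c (Act F t (\<xi> k))"
    using Act_Comp[OF G t \<alpha>_closed \<eta>] nat_trans_natural[OF u t \<xi>] u_pres by simp
  also have "\<dots> = \<one>\<^bsub>Grp G c\<^esub>"
    using Act_closed[OF F t \<xi>] vanish(1) nat_trans_one[OF u F G c] by (simp add: vanishes_def)
  finally show "b = \<one>\<^bsub>Grp G c\<^esub>" .
qed

text \<open>A commutative square with the map of colimits induced by \<open>\<alpha>\<close> is turned into an equation between
  elements.  Of \<open>\<phi>\<close> and \<open>\<psi>\<close> only the values on representatives enter; so \<open>\<psi>\<close> can also be an isomorphism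
  followed by the canonical map \<open>colim_shift\<close>.\<close>

lemma colim_map_presentation:
  assumes F: "F \<in> modules T" and G: "G \<in> modules T" and u: "u \<in> nat_trans T F G"
    and d: "sequence T d" and e: "sequence T e" and \<alpha>: "seq_morphism T d e \<alpha>"
    and presF: "colim_presentation T d F \<xi>" and presG: "colim_presentation T e G \<eta>"
    and \<phi>: "\<And>n x s. s \<in> homs T x (Dom T (d n)) \<Longrightarrow> \<phi> x (Act F s (\<xi> n)) = colim_rel T d x `` {(n, s)}"
    and \<psi>: "\<And>n x s. s \<in> homs T x (Dom T (e n)) \<Longrightarrow> \<psi> x (Act G s (\<eta> n)) = colim_rel T e x `` {(n, s)}"
    and comm: "\<And>x a. x \<in> Obj T \<Longrightarrow> a \<in> carrier (Grp F x) \<Longrightarrow> colim_map T d e \<alpha> x (\<phi> x a) = \<psi> x (u x a)"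
  shows "u (Dom T (d n)) (\<xi> n) = Act G (\<alpha> n) (\<eta> n)"
proof -
  let ?x = "Dom T (d n)"
  have x: "?x \<in> Obj T"
    using d by (rule sequence_Obj)
  note \<xi> = colim_presentation_closed[OF presF, of n]
  have \<alpha>n: "\<alpha> n \<in> homs T ?x (Dom T (e n))"
    using \<alpha> by (simp add: seq_morphism_def)
  have "\<psi> ?x (u ?x (\<xi> n)) = colim_map T d e \<alpha> ?x (\<phi> ?x (\<xi> n))"
    using comm[OF x \<xi>] by simp
  also have "\<dots> = colim_rel T e ?x `` {(n, \<alpha> n)}"
    using \<phi>[OF Id_closed[OF x]] Act_Id[OF F x \<xi>] colim_map_class[OF d e \<alpha> Id_closed[OF x]] Id_right[OF \<alpha>n]
    by simp
  finally have cls: "\<psi> ?x (u ?x (\<xi> n)) = colim_rel T e ?x `` {(n, \<alpha> n)}" .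
  obtain m t where t: "t \<in> homs T ?x (Dom T (e m))" and ut: "u ?x (\<xi> n) = Act G t (\<eta> m)"
    using colim_presentation_E[OF presG x nat_trans_closed[OF u x \<xi>]] .
  have "((m, t), (n, \<alpha> n)) \<in> colim_rel T e ?x"
    using colim_class_eqD[OF e \<alpha>n] cls \<psi>[OF t] ut by simp
  then show ?thesis
    using colim_presentation_rel_iff[OF G e presG t \<alpha>n] ut by simp
qed

end

section \<open>Completions\<close>

lemma completion_simps:
  fixes B :: "nat \<Rightarrow> 'o set" and T :: "('o, 'a, 'z) tri_data_scheme"
  defines "D \<equiv> completion T B :: (('o, 'a, 'm) presheaf, ('o, 'a, 'm) presheaf_map) tri_data"
  shows "Obj D = compactly_supported T B \<inter> pre_completion T B"
    "Arr D = {(F, \<eta>, G). F \<in> Obj D \<and> G \<in> Obj D \<and> (F, \<eta>, G) \<in> Arr (Mod T)}"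
    "Dom D (F, \<eta>, G) = F" "Cod D (F, \<eta>, G) = G"
    "Id D F = (F, nt_id T F, F)"
    "Comp D (G, \<theta>, H) (F, \<eta>, G') = (F, nt_comp T F \<theta> \<eta>, H)"
    "Add D (F, \<eta>, G) (F', \<theta>, G') = (F, nt_add T F G \<eta> \<theta>, G)"
    "Zero D F G = (F, nt_zero T F G, G)"
    "ShO D = shift_mod T"
  by (simp_all add: D_def completion_def Let_def Mod_def)

text \<open>The condition on the triangles of a completion, separated from the condition that the vertices
  belong to the completion; it depends on the metric only through its good Cauchy sequences.\<close>

definition colim_triangle :: "('o, 'a, 'z) tri_data_scheme \<Rightarrow> (nat \<Rightarrow> 'o set) \<Rightarrow>
    ('o, 'a, 'm) presheaf \<Rightarrow> ('o \<Rightarrow> 'm \<Rightarrow> 'm) \<Rightarrow> ('o, 'a, 'm) presheaf \<Rightarrow> ('o \<Rightarrow> 'm \<Rightarrow> 'm) \<Rightarrow>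
    ('o, 'a, 'm) presheaf \<Rightarrow> ('o \<Rightarrow> 'm \<Rightarrow> 'm) \<Rightarrow> bool" where
  "colim_triangle T B F u G v H w \<longleftrightarrow>
     u \<in> nat_trans T F G \<and> v \<in> nat_trans T G H \<and> w \<in> nat_trans T H (shift_mod T F) \<and>
     (\<exists>p q r \<alpha> \<beta> \<gamma>. Cauchy_triangles T B p q r \<alpha> \<beta> \<gamma> \<and>
       (\<exists>\<phi> \<in> nat_isos T F (colim_yoneda T p).
        \<exists>\<psi> \<in> nat_isos T G (colim_yoneda T q).
        \<exists>\<chi> \<in> nat_isos T H (colim_yoneda T r).
          nt_comp T F (colim_map T p q \<alpha>) \<phi> = nt_comp T F \<psi> u \<and>
          nt_comp T G (colim_map T q r \<beta>) \<psi> = nt_comp T G \<chi> v \<and>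
          nt_comp T H (colim_map T r (\<lambda>n. ShA T (p n)) \<gamma>) \<chi> =
            nt_comp T H (colim_shift T p) (nt_comp T H (shift_nt T \<phi>) w)))"

lemma Tri_completion_iff:
  fixes B :: "nat \<Rightarrow> 'o set" and T :: "('o, 'a, 'z) tri_data_scheme"
  defines "D \<equiv> completion T B :: (('o, 'a, 'm) presheaf, ('o, 'a, 'm) presheaf_map) tri_data"
  shows "((F, u, G), (G', v, H), (H', w, F')) \<in> Tri D \<longleftrightarrow>
    F \<in> Obj D \<and> G \<in> Obj D \<and> H \<in> Obj D \<and> G' = G \<and> H' = H \<and> F' = shift_mod T F \<and>
    colim_triangle T B F u G v H w"
  by (simp add: D_def completion_def Let_def colim_triangle_def)

context triangulated_category
begin

lemma shift_mod_in_modules: "F \<in> modules T \<Longrightarrow> shift_mod T F \<in> modules T"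
  unfolding shift_mod_eq_pullback by (rule shift.inverse.pullback_mod_in_modules)

lemma shift_mod_vanishes: "x \<in> Obj T \<Longrightarrow> vanishes (shift_mod T F) x \<longleftrightarrow> vanishes F (ShO_inv T x)"
  by (simp add: vanishes_def shift_mod_def)

lemma colim_shift_class:
  assumes e: "sequence T e" and s: "s \<in> homs T (ShO_inv T x) (Dom T (e n))" and x: "x \<in> Obj T"
  shows "colim_shift T e x (colim_rel T e (ShO_inv T x) `` {(n, s)}) =
    colim_rel T (\<lambda>n. ShA T (e n)) x `` {(n, ShA T s)}"
proof -
  have "((m, ShA T f), (k, ShA T g)) \<in> colim_rel T (\<lambda>n. ShA T (e n)) x"
    if "((m, f), (k, g)) \<in> colim_rel T e (ShO_inv T x)" for m f k g
    using shift.colim_rel_image[OF e that] by (simp add: ShO_ShO_inv x)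
  from colim_map_on_class[OF e shift.sequence_image(1)[OF e] s, of "\<lambda>m g. ShA T g", OF this]
  show ?thesis
    using colim_class_in_carrier[of s _ e n] s x by (simp add: colim_shift_def)
qed

text \<open>These are consequences of the long exact sequence
  \<open>F(c) \<rightarrow> G(c) \<rightarrow> H(c) \<rightarrow> F(\<Sigma>\<^sup>-\<^sup>1 c) \<rightarrow> G(\<Sigma>\<^sup>-\<^sup>1 c)\<close>.  Its exactness at the three inner terms is the exactness of
  the colimits of the sequences \<open>p \<rightarrow> q \<rightarrow> r\<close>, \<open>q \<rightarrow> r \<rightarrow> \<Sigma>p\<close> and \<open>r \<rightarrow> \<Sigma>p \<rightarrow> \<Sigma>q\<close>; the last claim uses the third
  of these at the object \<open>\<Sigma>c\<close>.\<close>

lemma colim_triangle_vanishes: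
  assumes F: "F \<in> modules T" and G: "G \<in> modules T" and H: "H \<in> modules T"
    and tri: "colim_triangle T B F u G v H w" and c: "c \<in> Obj T"
  shows "vanishes F c \<Longrightarrow> vanishes H c \<Longrightarrow> vanishes G c"
    and "vanishes G c \<Longrightarrow> vanishes F (ShO_inv T c) \<Longrightarrow> vanishes H c"
    and "vanishes G c \<Longrightarrow> vanishes H (ShO T c) \<Longrightarrow> vanishes F c"
proof -
  note SF = shift_mod_in_modules[OF F] and SG = shift_mod_in_modules[OF G]
  have u: "u \<in> nat_trans T F G" and v: "v \<in> nat_trans T G H" and w: "w \<in> nat_trans T H (shift_mod T F)"
    using tri by (simp_all add: colim_triangle_def)
  obtain p q r \<alpha> \<beta> \<gamma> \<phi> \<psi> \<chi> where Cauchy: "Cauchy_triangles T B p q r \<alpha> \<beta> \<gamma>"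
    and \<phi>: "\<phi> \<in> nat_isos T F (colim_yoneda T p)" and \<psi>: "\<psi> \<in> nat_isos T G (colim_yoneda T q)"
    and \<chi>: "\<chi> \<in> nat_isos T H (colim_yoneda T r)"
    and comm: "nt_comp T F (colim_map T p q \<alpha>) \<phi> = nt_comp T F \<psi> u"
      "nt_comp T G (colim_map T q r \<beta>) \<psi> = nt_comp T G \<chi> v"
      "nt_comp T H (colim_map T r (\<lambda>n. ShA T (p n)) \<gamma>) \<chi> =
         nt_comp T H (colim_shift T p) (nt_comp T H (shift_nt T \<phi>) w)"
    using tri unfolding colim_triangle_def by blast
  have p: "sequence T p" and q: "sequence T q" and r: "sequence T r"
    and \<alpha>: "seq_morphism T p q \<alpha>" and \<beta>: "seq_morphism T q r \<beta>"
    and \<gamma>: "seq_morphism T r (\<lambda>n. ShA T (p n)) \<gamma>" and Tri: "\<And>n. (\<alpha> n, \<beta> n, \<gamma> n) \<in> Tri T"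
    using Cauchy good_Cauchy_sequence unfolding Cauchy_triangles_def by blast+
  note Sp = shift.sequence_image(1)[OF p] and Sq = shift.sequence_image(1)[OF q]
  note DomS = shift.sequence_image(2)[OF p] shift.sequence_image(2)[OF q]
  note P = sequence_Obj[OF p] and Q = sequence_Obj[OF q]
  obtain \<xi> where \<xi>: "colim_presentation T p F \<xi>"
    and \<phi>_class: "\<And>n x s. s \<in> homs T x (Dom T (p n)) \<Longrightarrow> \<phi> x (Act F s (\<xi> n)) = colim_rel T p x `` {(n, s)}"
    using colim_presentation_of_iso[OF F p \<phi>] by blast
  obtain \<eta> where \<eta>: "colim_presentation T q G \<eta>"
    and \<psi>_class: "\<And>n x s. s \<in> homs T x (Dom T (q n)) \<Longrightarrow> \<psi> x (Act G s (\<eta> n)) = colim_rel T q x `` {(n, s)}"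
    using colim_presentation_of_iso[OF G q \<psi>] by blast
  obtain \<zeta> where \<zeta>: "colim_presentation T r H \<zeta>"
    and \<chi>_class: "\<And>n x s. s \<in> homs T x (Dom T (r n)) \<Longrightarrow> \<chi> x (Act H s (\<zeta> n)) = colim_rel T r x `` {(n, s)}"
    using colim_presentation_of_iso[OF H r \<chi>] by blast
  have S\<xi>: "colim_presentation T (\<lambda>n. ShA T (p n)) (shift_mod T F) \<xi>"
    and S\<eta>: "colim_presentation T (\<lambda>n. ShA T (q n)) (shift_mod T G) \<eta>"
    using shift.pullback_colim_presentation[OF p \<xi>] shift.pullback_colim_presentation[OF q \<eta>]
    by (simp_all add: shift_mod_eq_pullback)
  have \<alpha>_closed: "\<alpha> n \<in> homs T (Dom T (p n)) (Dom T (q n))"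
    and \<beta>_closed: "\<beta> n \<in> homs T (Dom T (q n)) (Dom T (r n))"
    and \<gamma>_closed: "\<gamma> n \<in> homs T (Dom T (r n)) (ShO T (Dom T (p n)))" for n
    using \<alpha> \<beta> \<gamma> by (simp_all add: seq_morphism_def DomS)
  have S\<alpha>: "seq_morphism T (\<lambda>n. ShA T (p n)) (\<lambda>n. ShA T (q n)) (\<lambda>n. ShA T (\<alpha> n))"
    using \<alpha> ShA_closed[OF \<alpha>_closed] ShA_Comp[OF sequence_homs[OF p] \<alpha>_closed]
      ShA_Comp[OF \<alpha>_closed sequence_homs[OF q]]
    by (simp add: seq_morphism_def DomS)
  have u_pres: "u (Dom T (p n)) (\<xi> n) = Act G (\<alpha> n) (\<eta> n)" for n
  proof (rule colim_map_presentation[OF F G u p q \<alpha> \<xi> \<eta> \<phi>_class \<psi>_class])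
    show "colim_map T p q \<alpha> x (\<phi> x a) = \<psi> x (u x a)" if "x \<in> Obj T" "a \<in> carrier (Grp F x)" for x a
      using fun_cong[OF fun_cong[OF comm(1)], of x a] that by (simp add: nt_comp_def)
  qed
  have v_pres: "v (Dom T (q n)) (\<eta> n) = Act H (\<beta> n) (\<zeta> n)" for n
  proof (rule colim_map_presentation[OF G H v q r \<beta> \<eta> \<zeta> \<psi>_class \<chi>_class])
    show "colim_map T q r \<beta> x (\<psi> x a) = \<chi> x (v x a)" if "x \<in> Obj T" "a \<in> carrier (Grp G x)" for x a
      using fun_cong[OF fun_cong[OF comm(2)], of x a] that by (simp add: nt_comp_def)
  qed
  have w_pres: "w (Dom T (r n)) (\<zeta> n) = Act (shift_mod T F) (\<gamma> n) (\<xi> n)" for n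
  proof (rule colim_map_presentation[OF H SF w r Sp \<gamma> \<zeta> S\<xi> \<chi>_class])
    show "colim_shift T p x (\<phi> (ShO_inv T x) (Act (shift_mod T F) s (\<xi> n))) =
        colim_rel T (\<lambda>n. ShA T (p n)) x `` {(n, s)}" if s: "s \<in> homs T x (Dom T (ShA T (p n)))" for n x s
    proof -
      have x: "x \<in> Obj T"
        using s by (rule homs_Obj)
      have s': "ShA_inv T s \<in> homs T (ShO_inv T x) (Dom T (p n))"
        using ShA_inv_closed[OF s] by (simp add: DomS ShO_inv_ShO P)
      show ?thesis
        using \<phi>_class[OF s'] colim_shift_class[OF p s' x] homsD(1)[OF s] by (simp add: shift_mod_def ShA_ShA_inv)
    qed
    show "colim_map T r (\<lambda>n. ShA T (p n)) \<gamma> x (\<chi> x a) = colim_shift T p x (\<phi> (ShO_inv T x) (w x a))"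
      if "x \<in> Obj T" "a \<in> carrier (Grp H x)" for x a
      using fun_cong[OF fun_cong[OF comm(3)], of x a] that by (simp add: nt_comp_def shift_nt_def)
  qed
  have Su: "shift_nt T u \<in> nat_trans T (shift_mod T F) (shift_mod T G)"
    unfolding shift_nt_def shift_mod_eq_pullback by (rule shift.inverse.pullback_nat_trans[OF u])
  have Su_pres: "shift_nt T u (Dom T (ShA T (p n))) (\<xi> n) = Act (shift_mod T G) (ShA T (\<alpha> n)) (\<eta> n)" for n
    using u_pres[of n] homsD(1)[OF \<alpha>_closed, of n]
    by (simp add: shift_nt_def shift_mod_def DomS ShO_closed P ShO_inv_ShO ShA_Arr ShA_inv_ShA)
  note dom = homsD[OF \<alpha>_closed] homsD[OF \<beta>_closed] homsD[OF \<gamma>_closed]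
  show "vanishes G c" if "vanishes F c" "vanishes H c"
  proof (rule vanishes_of_exact_sequence[OF F G H u v p q r \<alpha> \<beta> \<xi> \<eta> \<zeta> u_pres v_pres _ c that])
    show "\<exists>t \<in> homs T c (Dom T (p n)). \<alpha> n \<cdot> t = s"
      if "s \<in> homs T c (Dom T (q n))" "\<beta> n \<cdot> s = Zero T c (Dom T (r n))" for n c s
      using Tri_exact1[OF Tri[of n], of s c] that by (auto simp: dom)
  qed
  show "vanishes H c" if "vanishes G c" "vanishes F (ShO_inv T c)"
  proof (rule vanishes_of_exact_sequence[OF G H SF v w q r Sp \<beta> \<gamma> \<eta> \<zeta> S\<xi> v_pres w_pres _ c that(1)])
    show "\<exists>t \<in> homs T c (Dom T (q n)). \<beta> n \<cdot> t = s"
      if "s \<in> homs T c (Dom T (r n))" "\<gamma> n \<cdot> s = Zero T c (Dom T (ShA T (p n)))" for n c s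
      using Tri_exact2[OF Tri[of n], of s c] that by (auto simp: dom DomS)
  qed (use that c in \<open>simp add: shift_mod_vanishes\<close>)
  show "vanishes F c" if "vanishes G c" "vanishes H (ShO T c)"
  proof -
    have "vanishes (shift_mod T F) (ShO T c)"
    proof (rule vanishes_of_exact_sequence[OF H SF SG w Su r Sp Sq \<gamma> S\<alpha> \<zeta> S\<xi> S\<eta> w_pres Su_pres _
          ShO_closed[OF c] that(2)])
      show "\<exists>t \<in> homs T c (Dom T (r n)). \<gamma> n \<cdot> t = s"
        if "s \<in> homs T c (Dom T (ShA T (p n)))" "ShA T (\<alpha> n) \<cdot> s = Zero T c (Dom T (ShA T (q n)))" for n c s
        using Tri_exact3[OF Tri[of n], of s c] that by (auto simp: dom DomS)
    qed (use that c in \<open>simp add: shift_mod_vanishes ShO_closed ShO_inv_ShO\<close>)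
    then show ?thesis
      by (simp add: shift_mod_vanishes ShO_closed ShO_inv_ShO c)
  qed
qed

lemma compactly_supported_iff:
  assumes B: "metric T B"
  shows "F \<in> compactly_supported T B \<longleftrightarrow>
    F \<in> modules T \<and> (\<forall>j. \<exists>i. \<forall>c \<in> B i. vanishes F (shift_pow T j c))"
proof -
  have "c \<in> Obj T" if "c \<in> B i" for c i
    using B that by (auto simp: metric_def)
  then have "nat_trans T (yoneda T (shift_pow T j c)) F = {nt_zero T (yoneda T (shift_pow T j c)) F} \<longleftrightarrow>
      vanishes F (shift_pow T j c)" if "F \<in> modules T" "c \<in> B i" for i j c
    using yoneda_perp_iff[OF that(1) shift_pow_closed] that(2) by blast
  then have "F \<in> right_perp T (yoneda T ` shift_pow T j ` B i) \<longleftrightarrow>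
      F \<in> modules T \<and> (\<forall>c \<in> B i. vanishes F (shift_pow T j c))" for i j
    unfolding right_perp_def by (simp cong: conj_cong ball_cong)
  then show ?thesis
    by (auto simp: compactly_supported_def)
qed

text \<open>This reduces all closure properties of compact support to vanishing at single objects.  The
  shifts \<open>k\<close> and \<open>l\<close> account for the connecting morphisms of triangles.  As a metric is decreasing,
  the larger of the indices for \<open>M\<close> and for \<open>N\<close> serves for \<open>K\<close>.\<close>

lemma compactly_supported_of_two:
  assumes B: "metric T B" and M: "M \<in> compactly_supported T B" and N: "N \<in> compactly_supported T B"
    and K: "K \<in> modules T"
    and vanish: "\<And>c. c \<in> Obj T \<Longrightarrow> vanishes M (shift_pow T k c) \<Longrightarrow> vanishes N (shift_pow T l c) \<Longrightarrow> vanishes K c"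
  shows "K \<in> compactly_supported T B"
  unfolding compactly_supported_iff[OF B]
proof (intro conjI allI K)
  fix j
  obtain i where i: "\<forall>c \<in> B i. vanishes M (shift_pow T (k + j) c)"
    using M by (auto simp: compactly_supported_iff[OF B])
  obtain i' where i': "\<forall>c \<in> B i'. vanishes N (shift_pow T (l + j) c)"
    using N by (auto simp: compactly_supported_iff[OF B])
  have "vanishes K (shift_pow T j c)" if c: "c \<in> B (max i i')" for c
  proof (rule vanish)
    have "c \<in> B i" "c \<in> B i'"
      using c metric_antimono[OF B, of i "max i i'"] metric_antimono[OF B, of i' "max i i'"] by auto
    moreover have cO: "c \<in> Obj T"
      using c B by (auto simp: metric_def)
    ultimately show "vanishes M (shift_pow T k (shift_pow T j c))" "vanishes N (shift_pow T l (shift_pow T j c))"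
      using i i' by (simp_all add: shift_pow_add)
    show "shift_pow T j c \<in> Obj T"
      using cO by (rule shift_pow_closed)
  qed
  then show "\<exists>i. \<forall>c \<in> B i. vanishes K (shift_pow T j c)"
    by blast
qed

lemma compactly_supported_improvement:
  "compactly_supported T B \<subseteq> compactly_supported T (improvement T B)"
proof -
  have "right_perp T (yoneda T ` shift_pow T j ` B i) \<subseteq>
      right_perp T (yoneda T ` shift_pow T j ` improvement T B i)" for i j
    using improvement_subset[of B i] by (auto simp: right_perp_def)
  then show ?thesis
    unfolding compactly_supported_def by blast
qed

lemma pre_completion_improvement:
  "metric T B \<Longrightarrow> pre_completion T (improvement T B) = pre_completion T B"
  by (simp add: pre_completion_def good_Cauchy_improvement_iff)

lemma colim_triangle_improvement:
  "metric T B \<Longrightarrow> colim_triangle T (improvement T B) F u G v H w \<longleftrightarrow> colim_triangle T B F u G v H w"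
  by (simp add: colim_triangle_def Cauchy_triangles_def good_Cauchy_improvement_iff)

lemma pre_completion_presentation:
  "F \<in> pre_completion T B \<longleftrightarrow>
    F \<in> modules T \<and> (\<exists>e \<xi>. good_Cauchy T B e \<and> colim_presentation T e F \<xi>)"
proof
  assume "F \<in> pre_completion T B"
  then obtain e \<phi> where F: "F \<in> modules T" and e: "good_Cauchy T B e" and \<phi>: "\<phi> \<in> nat_isos T F (colim_yoneda T e)"
    by (auto simp: pre_completion_def)
  obtain \<xi> where "colim_presentation T e F \<xi>"
    using colim_presentation_of_iso[OF F good_Cauchy_sequence[OF e] \<phi>] .
  then show "F \<in> modules T \<and> (\<exists>e \<xi>. good_Cauchy T B e \<and> colim_presentation T e F \<xi>)"
    using F e by blast
next
  assume "F \<in> modules T \<and> (\<exists>e \<xi>. good_Cauchy T B e \<and> colim_presentation T e F \<xi>)"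
  then show "F \<in> pre_completion T B"
    using iso_of_colim_presentation good_Cauchy_sequence unfolding pre_completion_def by blast
qed

lemma shift_mod_in_completion:
  assumes B: "metric T B" and F: "F \<in> compactly_supported T B \<inter> pre_completion T B"
  shows "shift_mod T F \<in> compactly_supported T B \<inter> pre_completion T B"
proof
  have F_mod: "F \<in> modules T" and F_cs: "F \<in> compactly_supported T B"
    using F by (auto simp: pre_completion_def)
  show "shift_mod T F \<in> compactly_supported T B"
    by (rule compactly_supported_of_two[OF B F_cs F_cs shift_mod_in_modules[OF F_mod], of "- 1" "- 1"])
      (simp add: shift_mod_vanishes ShO_inv_eq_shift_pow)
  show "shift_mod T F \<in> pre_completion T B"
    using F shift_mod_in_modules[OF F_mod] good_Cauchy_ShA[of B]
      shift.pullback_colim_presentation[OF good_Cauchy_sequence[of B], of _ F]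
    unfolding pre_completion_presentation shift_mod_eq_pullback Int_iff by metis
qed

lemma unshift_mod_in_completion:
  assumes B: "metric T B" and F: "F \<in> compactly_supported T B \<inter> pre_completion T B"
  shows "pullback_mod T (ShO T) (ShA T) F \<in> compactly_supported T B \<inter> pre_completion T B"
proof
  have F_mod: "F \<in> modules T" and F_cs: "F \<in> compactly_supported T B"
    using F by (auto simp: pre_completion_def)
  show "pullback_mod T (ShO T) (ShA T) F \<in> compactly_supported T B"
    by (rule compactly_supported_of_two[OF B F_cs F_cs shift.pullback_mod_in_modules[OF F_mod], of 1 1])
      (simp add: vanishes_def pullback_mod_simps ShO_eq_shift_pow)
  show "pullback_mod T (ShO T) (ShA T) F \<in> pre_completion T B"
    using F shift.pullback_mod_in_modules[OF F_mod] good_Cauchy_ShA_inv[of B]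
      shift_inv.pullback_colim_presentation[OF good_Cauchy_sequence[of B], of _ F]
    unfolding pre_completion_presentation Int_iff by metis
qed

end

text \<open>The type of group elements is arbitrary; \<open>undefined\<close> is used as the one element that it surely has.\<close>

definition zero_module :: "('o, 'a, 'z) cat_data_scheme \<Rightarrow> ('o, 'a, 'm) presheaf" where
  "zero_module T = \<lparr>
     Grp = (\<lambda>x \<in> Obj T. \<lparr>carrier = {undefined}, mult = (\<lambda>a b. undefined), one = undefined\<rparr>),
     Act = (\<lambda>f \<in> Arr T. \<lambda>a \<in> {undefined}. undefined)\<rparr>"

context triangulated_category
begin

lemma zero_module_in_modules: "(zero_module T :: ('o, 'a, 'm) presheaf) \<in> modules T"
proof -
  have "comm_group \<lparr>carrier = {u}, mult = (\<lambda>a b. u), one = u\<rparr>" for u :: 'm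
    by (rule comm_groupI) auto
  moreover have "Id T x \<in> Arr T" if "x \<in> Obj T" for x
    using homsD(1)[OF Id_closed[OF that]] .
  moreover have "g \<cdot> f \<in> Arr T" if "f \<in> homs T x y" "g \<in> homs T y z" for f g x y z
    using homsD(1)[OF Comp_closed[OF that]] .
  moreover have "f \<boxplus> g \<in> Arr T" if "f \<in> homs T x y" "g \<in> homs T x y" for f g x y
    using homsD(1)[OF Add_closed[OF that]] .
  ultimately show ?thesis
    using homs_Obj homsD(1)
    by (simp add: modules_def zero_module_def hom_def Dom_closed Cod_closed)
qed

lemma carrier_zero_module: "x \<in> Obj T \<Longrightarrow> carrier (Grp (zero_module T) x) = {undefined}"
  by (simp add: zero_module_def)

lemma zero_module_in_completion:
  assumes B: "metric T B"
  shows "(zero_module T :: ('o, 'a, 'm) presheaf) \<in> compactly_supported T B \<inter> pre_completion T B"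
proof
  let ?Z = "zero_module T :: ('o, 'a, 'm) presheaf"
  have "vanishes ?Z x" if "x \<in> Obj T" for x
    using that by (simp add: vanishes_def zero_module_def)
  moreover have "c \<in> Obj T" if "c \<in> B i" for c i
    using B that by (auto simp: metric_def)
  ultimately show "?Z \<in> compactly_supported T B"
    unfolding compactly_supported_iff[OF B] using zero_module_in_modules shift_pow_closed by blast
  obtain z where z: "zero_object T z"
    using ex_zero_object by blast
  let ?e = "\<lambda>n :: nat. Id T z"
  have zO: "z \<in> Obj T"
    using z by (rule zero_object_Obj)
  note I = homsD[OF Id_closed[OF zO]]
  have e: "good_Cauchy T B ?e"
    using B z by (rule zero_sequence_good_Cauchy)
  have "colim_presentation T ?e ?Z (\<lambda>n. undefined)"
    unfolding colim_presentation_def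
  proof (intro conjI allI ballI impI)
    show "\<exists>n. \<exists>s \<in> homs T x (Dom T (?e n)). a = Act ?Z s undefined"
      if x: "x \<in> Obj T" and "a \<in> carrier (Grp ?Z x)" for x a
      using Zero_closed[OF x zO] that homsD(1)[OF Zero_closed[OF x zO]] I
      by (auto simp: zero_module_def intro!: bexI[of _ "Zero T x z"])
    show "((m, s), (n, t)) \<in> colim_rel T ?e x"
      if s: "s \<in> homs T x (Dom T (?e m))" and t: "t \<in> homs T x (Dom T (?e n))" for x m n s t
    proof -
      let ?k = "max m n"
      have "trans_map T ?e m ?k \<cdot> s \<in> homs T x z" "trans_map T ?e n ?k \<cdot> t \<in> homs T x z"
        using Comp_closed[OF s trans_map_closed[OF good_Cauchy_sequence[OF e], of m ?k]]
          Comp_closed[OF t trans_map_closed[OF good_Cauchy_sequence[OF e], of n ?k]] I by simp_all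
      then have "trans_map T ?e m ?k \<cdot> s = trans_map T ?e n ?k \<cdot> t"
        by (rule zero_object_to_eq[OF z])
      then show ?thesis
        using s t by (auto simp: colim_rel_iff intro!: exI[of _ ?k])
    qed
  qed (use I zO in \<open>simp_all add: zero_module_def\<close>)
  then show "?Z \<in> pre_completion T B"
    using e zero_module_in_modules unfolding pre_completion_presentation by blast
qed

lemma homs_completion_iff:
  "f \<in> homs (completion T B) F G \<longleftrightarrow>
    F \<in> Obj (completion T B) \<and> G \<in> Obj (completion T B) \<and> (\<exists>\<eta> \<in> nat_trans T F G. f = (F, \<eta>, G))"
  by (cases f) (auto simp: homs_def completion_simps Mod_def pre_completion_def)

lemma zero_module_zero_object:
  fixes B :: "nat \<Rightarrow> 'o set"
  defines "D \<equiv> completion T B :: (('o, 'a, 'm) presheaf, ('o, 'a, 'm) presheaf_map) tri_data"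
  assumes Z: "zero_module T \<in> Obj D"
  shows "zero_object D (zero_module T)"
  unfolding zero_object_def
proof (intro conjI ballI Z)
  let ?Z = "zero_module T :: ('o, 'a, 'm) presheaf"
  note iff = homs_completion_iff[of _ B, where ?'b = 'm, folded D_def]
  note Z_mod = zero_module_in_modules[where ?'m = 'm]
  have zero: "nt_zero T F G \<in> nat_trans T F G"
    if "F \<in> modules T" "G \<in> modules T" for F G :: "('o, 'a, 'm) presheaf"
    using that by (intro nt_zero_nat_trans monoid.m_closed[OF module_monoid] Act_closed)
  fix F assume F: "F \<in> Obj D"
  then have F_mod: "F \<in> modules T"
    by (simp add: D_def completion_simps pre_completion_def)
  have one: "\<one>\<^bsub>Grp ?Z x\<^esub> = undefined" if "x \<in> Obj T" for x
    using that by (simp add: zero_module_def)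
  have from_Z: "\<eta> = nt_zero T ?Z F" if \<eta>: "\<eta> \<in> nat_trans T ?Z F" for \<eta>
  proof (rule nat_trans_eqI[OF \<eta> zero[OF Z_mod F_mod]])
    show "\<eta> x a = nt_zero T ?Z F x a" if "x \<in> Obj T" "a \<in> carrier (Grp ?Z x)" for x a
      using nat_trans_one[OF \<eta> Z_mod F_mod that(1)] that
      by (simp add: carrier_zero_module one nt_zero_def)
  qed
  have to_Z: "\<eta> = nt_zero T F ?Z" if \<eta>: "\<eta> \<in> nat_trans T F ?Z" for \<eta>
  proof (rule nat_trans_eqI[OF \<eta> zero[OF F_mod Z_mod]])
    show "\<eta> x a = nt_zero T F ?Z x a" if "x \<in> Obj T" "a \<in> carrier (Grp F x)" for x a
      using nat_trans_closed[OF \<eta> that] that by (simp add: carrier_zero_module one nt_zero_def)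
  qed
  show "\<exists>!f. f \<in> homs D ?Z F"
  proof (rule ex1I)
    show "(?Z, nt_zero T ?Z F, F) \<in> homs D ?Z F"
      using zero[OF Z_mod F_mod] Z F by (simp add: iff)
    show "f = (?Z, nt_zero T ?Z F, F)" if "f \<in> homs D ?Z F" for f
      using that from_Z unfolding iff by blast
  qed
  show "\<exists>!f. f \<in> homs D F ?Z"
  proof (rule ex1I)
    show "(F, nt_zero T F ?Z, ?Z) \<in> homs D F ?Z"
      using zero[OF F_mod Z_mod] Z F by (simp add: iff)
    show "f = (F, nt_zero T F ?Z, ?Z)" if "f \<in> homs D F ?Z" for f
      using that to_Z unfolding iff by blast
  qed
qed

lemma retract_compactly_supported:
  assumes B: "metric T B" and F: "F \<in> compactly_supported T B" and G: "G \<in> modules T"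
    and u: "u \<in> nat_trans T F G" and v: "v \<in> nat_trans T G F" and id: "nt_comp T G u v = nt_id T G"
  shows "G \<in> compactly_supported T B"
proof (rule compactly_supported_of_two[OF B F F G, of 0 0])
  have F_mod: "F \<in> modules T"
    using F by (simp add: compactly_supported_iff[OF B])
  fix c assume c: "c \<in> Obj T" and "vanishes F (shift_pow T 0 c)"
  then have F0: "vanishes F c"
    by (simp add: shift_pow_0)
  show "vanishes G c"
    unfolding vanishes_def
  proof
    fix a assume a: "a \<in> carrier (Grp G c)"
    have "a = u c (v c a)"
      using fun_cong[OF fun_cong[OF id], of c a] a c by (simp add: nt_comp_def nt_id_def)
    also have "v c a = \<one>\<^bsub>Grp F c\<^esub>"
      using nat_trans_closed[OF v c a] F0 by (simp add: vanishes_def)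
    finally show "a = \<one>\<^bsub>Grp G c\<^esub>"
      using nat_trans_one[OF u F_mod G c] by simp
  qed
qed

lemma biproduct_compactly_supported:
  assumes B: "metric T B" and F: "F \<in> compactly_supported T B" and G: "G \<in> compactly_supported T B"
    and P: "P \<in> modules T"
    and i: "i \<in> nat_trans T F P" and j: "j \<in> nat_trans T G P"
    and q: "q \<in> nat_trans T P F" and r: "r \<in> nat_trans T P G"
    and id: "nt_add T P P (nt_comp T P i q) (nt_comp T P j r) = nt_id T P"
  shows "P \<in> compactly_supported T B"
proof (rule compactly_supported_of_two[OF B F G P, of 0 0])
  have F_mod: "F \<in> modules T" and G_mod: "G \<in> modules T"
    using F G by (simp_all add: compactly_supported_iff[OF B])
  fix c assume c: "c \<in> Obj T" and "vanishes F (shift_pow T 0 c)" "vanishes G (shift_pow T 0 c)"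
  then have vanish: "vanishes F c" "vanishes G c"
    by (simp_all add: shift_pow_0)
  show "vanishes P c"
    unfolding vanishes_def
  proof
    fix a assume a: "a \<in> carrier (Grp P c)"
    have "a = i c (q c a) \<otimes>\<^bsub>Grp P c\<^esub> j c (r c a)"
      using fun_cong[OF fun_cong[OF id], of c a] a c by (simp add: nt_add_def nt_comp_def nt_id_def)
    also have "q c a = \<one>\<^bsub>Grp F c\<^esub>"
      using nat_trans_closed[OF q c a] vanish by (simp add: vanishes_def)
    also have "r c a = \<one>\<^bsub>Grp G c\<^esub>"
      using nat_trans_closed[OF r c a] vanish by (simp add: vanishes_def)
    finally show "a = \<one>\<^bsub>Grp P c\<^esub>"
      using nat_trans_one[OF i F_mod P c] nat_trans_one[OF j G_mod P c]
        monoid.l_one[OF module_monoid[OF P c] one_in_module[OF P c]] by simp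
  qed
qed

lemma colim_triangle_compactly_supported:
  assumes B: "metric T B" and mods: "F \<in> modules T" "G \<in> modules T" "H \<in> modules T"
    and tri: "colim_triangle T B' F u G v H w"
  shows "F \<in> compactly_supported T B \<Longrightarrow> G \<in> compactly_supported T B \<Longrightarrow> H \<in> compactly_supported T B"
    and "G \<in> compactly_supported T B \<Longrightarrow> H \<in> compactly_supported T B \<Longrightarrow> F \<in> compactly_supported T B"
    and "F \<in> compactly_supported T B \<Longrightarrow> H \<in> compactly_supported T B \<Longrightarrow> G \<in> compactly_supported T B"
proof -
  note vanish = colim_triangle_vanishes[OF mods tri]
  show "H \<in> compactly_supported T B" if "F \<in> compactly_supported T B" "G \<in> compactly_supported T B"
    by (rule compactly_supported_of_two[OF B that mods(3), of "- 1" 0])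
      (rule vanish(2), simp_all add: shift_pow_0 ShO_inv_eq_shift_pow)
  show "F \<in> compactly_supported T B" if "G \<in> compactly_supported T B" "H \<in> compactly_supported T B"
    by (rule compactly_supported_of_two[OF B that mods(1), of 0 1])
      (rule vanish(3), simp_all add: shift_pow_0 ShO_eq_shift_pow)
  show "G \<in> compactly_supported T B" if "F \<in> compactly_supported T B" "H \<in> compactly_supported T B"
    by (rule compactly_supported_of_two[OF B that mods(2), of 0 0])
      (rule vanish(1), simp_all add: shift_pow_0)
qed

end

theorem corollary5p9:
  fixes T :: "('o, 'a) tri_data"
    and B :: "nat \<Rightarrow> 'o set"
  assumes "triangulated_category T"
    and "metric T B"
  shows "triangulated_subcategory
           (completion T B :: (('o, 'a, 'm) presheaf, ('o, 'a, 'm) presheaf_map) tri_data)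
           (completion T (improvement T B))"
proof -
  interpret triangulated_category T by (rule assms(1))
  note B = assms(2)
  let ?D = "completion T B :: (('o, 'a, 'm) presheaf, ('o, 'a, 'm) presheaf_map) tri_data"
  let ?E = "completion T (improvement T B) :: (('o, 'a, 'm) presheaf, ('o, 'a, 'm) presheaf_map) tri_data"
  have ObjD: "Obj ?D = compactly_supported T B \<inter> pre_completion T B"
    and ObjE: "Obj ?E = compactly_supported T (improvement T B) \<inter> pre_completion T B"
    by (simp_all add: completion_simps pre_completion_improvement[OF B])
  have sub: "Obj ?D \<subseteq> Obj ?E"
    using compactly_supported_improvement[of B] by (auto simp: ObjD ObjE)
  \<comment> \<open>so that below only compact support with respect to \<open>B\<close> has to be proved\<close>
  have ObjD_iff: "F \<in> Obj ?D \<longleftrightarrow> F \<in> compactly_supported T B" if "F \<in> Obj ?E" for F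
    using that by (simp add: ObjD ObjE)
  have modules: "F \<in> modules T" if "F \<in> Obj ?E" for F
    using that by (simp add: ObjE pre_completion_def)
  have full: "homs ?D F G = homs ?E F G" if "F \<in> Obj ?D" "G \<in> Obj ?D" for F G
    using that sub by (auto simp: homs_completion_iff)
  have Arr: "Arr ?D = (\<Union>F \<in> Obj ?D. \<Union>G \<in> Obj ?D. homs ?E F G)"
    using sub by (auto simp: homs_def completion_simps(2-4))
  have iso: "G \<in> Obj ?D" if F: "F \<in> Obj ?D" and G: "G \<in> Obj ?E" and isos: "isos ?E F G \<noteq> {}" for F G
  proof -
    obtain f g where f: "f \<in> homs ?E F G" and g: "g \<in> homs ?E G F" and fg: "f \<cdot>\<^bsub>?E\<^esub> g = Id ?E G"
      using isos by (auto simp: isos_def)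
    obtain u v where u: "u \<in> nat_trans T F G" "f = (F, u, G)" and v: "v \<in> nat_trans T G F" "g = (G, v, F)"
      using f g by (auto simp: homs_completion_iff)
    have "nt_comp T G u v = nt_id T G"
      using fg by (simp add: u v completion_simps)
    then have "G \<in> compactly_supported T B"
      using retract_compactly_supported[OF B _ modules[OF G] u(1) v(1)] F by (simp add: ObjD)
    then show ?thesis
      by (simp add: ObjD_iff[OF G])
  qed
  have zero: "\<exists>Z \<in> Obj ?D. zero_object ?E Z"
  proof
    show Z: "zero_module T \<in> Obj ?D"
      using zero_module_in_completion[OF B] by (simp add: ObjD)
    then show "zero_object ?E (zero_module T)"
      using sub by (intro zero_module_zero_object) auto
  qed
  have biprod: "P \<in> Obj ?D" if F: "F \<in> Obj ?D" and G: "G \<in> Obj ?D" and P_biproduct: "biproduct ?E F G P" for F G P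
  proof -
    obtain i j q r where P: "P \<in> Obj ?E" and i: "i \<in> homs ?E F P" and j: "j \<in> homs ?E G P"
      and q: "q \<in> homs ?E P F" and r: "r \<in> homs ?E P G"
      and id: "(i \<cdot>\<^bsub>?E\<^esub> q) \<boxplus>\<^bsub>?E\<^esub> (j \<cdot>\<^bsub>?E\<^esub> r) = Id ?E P"
      using P_biproduct unfolding biproduct_def by blast
    obtain i' j' q' r' where i': "i' \<in> nat_trans T F P" "i = (F, i', P)"
      and j': "j' \<in> nat_trans T G P" "j = (G, j', P)"
      and q': "q' \<in> nat_trans T P F" "q = (P, q', F)"
      and r': "r' \<in> nat_trans T P G" "r = (P, r', G)"
      using i j q r by (auto simp: homs_completion_iff)
    have "nt_add T P P (nt_comp T P i' q') (nt_comp T P j' r') = nt_id T P"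
      using id by (simp add: i' j' q' r' completion_simps)
    then have "P \<in> compactly_supported T B"
      using biproduct_compactly_supported[OF B _ _ modules[OF P] i'(1) j'(1) q'(1) r'(1)] F G
      by (simp add: ObjD)
    then show ?thesis
      by (simp add: ObjD_iff[OF P])
  qed
  have shift: "shift_mod T F \<in> Obj ?D" if "F \<in> Obj ?D" for F
    using shift_mod_in_completion[OF B] that by (simp add: ObjD)
  have shift_onto: "shift_mod T ` Obj ?D = Obj ?D"
  proof (intro equalityI subsetI)
    fix F assume F: "F \<in> Obj ?D"
    then have "pullback_mod T (ShO T) (ShA T) F \<in> Obj ?D"
      using unshift_mod_in_completion[OF B] by (simp add: ObjD)
    moreover have "shift_mod T (pullback_mod T (ShO T) (ShA T) F) = F"
      using F sub modules shift.pullback_mod_cancel[of F] by (auto simp: shift_mod_eq_pullback)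
    ultimately show "F \<in> shift_mod T ` Obj ?D"
      by (metis imageI)
  qed (use shift in auto)
  have Tri_iff: "((F, u, G), (G', v, H), (H', w, F')) \<in> Tri ?E \<longleftrightarrow>
      F \<in> Obj ?E \<and> G \<in> Obj ?E \<and> H \<in> Obj ?E \<and> G' = G \<and> H' = H \<and> F' = shift_mod T F \<and>
      colim_triangle T B F u G v H w" for F u G G' v H H' w F'
    by (simp add: Tri_completion_iff colim_triangle_improvement[OF B])
  have two_of_three: "(Dom ?E f \<in> Obj ?D \<and> Cod ?E f \<in> Obj ?D \<longrightarrow> Cod ?E g \<in> Obj ?D) \<and>
      (Cod ?E f \<in> Obj ?D \<and> Cod ?E g \<in> Obj ?D \<longrightarrow> Dom ?E f \<in> Obj ?D) \<and>
      (Dom ?E f \<in> Obj ?D \<and> Cod ?E g \<in> Obj ?D \<longrightarrow> Cod ?E f \<in> Obj ?D)"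
    if "(f, g, h) \<in> Tri ?E" for f g h
  proof -
    obtain F u G G' v H H' w F' where fgh: "f = (F, u, G)" "g = (G', v, H)" "h = (H', w, F')"
      by (metis prod_cases3)
    have mem: "F \<in> Obj ?E" "G \<in> Obj ?E" "H \<in> Obj ?E" and tri: "colim_triangle T B F u G v H w"
      using that by (auto simp: fgh Tri_iff)
    show ?thesis
      using colim_triangle_compactly_supported[OF B modules[OF mem(1)] modules[OF mem(2)]
          modules[OF mem(3)] tri]
      by (simp add: fgh completion_simps(3,4) ObjD_iff mem)
  qed
  have Arr_iff: "(F, u, G) \<in> Arr ?D \<longleftrightarrow> F \<in> Obj ?D \<and> G \<in> Obj ?D \<and> u \<in> nat_trans T F G" for F u G
    using sub modules by (auto simp: completion_simps(2) Mod_def)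
  have "((F, u, G), (G', v, H), (H', w, F')) \<in> Tri ?D \<longleftrightarrow>
      ((F, u, G), (G', v, H), (H', w, F')) \<in> Tri ?E \<and> (F, u, G) \<in> Arr ?D \<and> (G', v, H) \<in> Arr ?D \<and>
      (H', w, F') \<in> Arr ?D" for F u G G' v H H' w F'
  proof -
    have "u \<in> nat_trans T F G \<and> v \<in> nat_trans T G H \<and> w \<in> nat_trans T H (shift_mod T F)"
      if "colim_triangle T B F u G v H w"
      using that by (simp add: colim_triangle_def)
    then show ?thesis
      using subsetD[OF sub, of F] subsetD[OF sub, of G] subsetD[OF sub, of H] shift[of F]
      unfolding Tri_completion_iff colim_triangle_improvement[OF B] Arr_iff by auto
  qed
  then have Tri: "Tri ?D = {(f, g, h) \<in> Tri ?E. f \<in> Arr ?D \<and> g \<in> Arr ?D \<and> h \<in> Arr ?D}"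
    by auto
  have same: "Id ?D = Id ?E" "Comp ?D = Comp ?E" "Zero ?D = Zero ?E" "Add ?D = Add ?E"
    "ShO ?D = ShO ?E" "ShA ?D = ShA ?E" "ShO ?E = shift_mod T"
    by (simp_all add: completion_def Let_def)
  show ?thesis
    unfolding triangulated_subcategory_def same
  proof (intro conjI ballI allI impI)
    show "Obj ?D \<subseteq> Obj ?E" by (rule sub)
    show "homs ?D F G = homs ?E F G" if "F \<in> Obj ?D" "G \<in> Obj ?D" for F G
      using that by (rule full)
    show "Arr ?D = (\<Union>F \<in> Obj ?D. \<Union>G \<in> Obj ?D. homs ?E F G)" by (rule Arr)
    show "G \<in> Obj ?D" if "F \<in> Obj ?D" "G \<in> Obj ?E" "isos ?E F G \<noteq> {}" for F G
      using that by (rule iso)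
    show "\<exists>Z \<in> Obj ?D. zero_object ?E Z" by (rule zero)
    show "P \<in> Obj ?D" if "F \<in> Obj ?D" "G \<in> Obj ?D" "biproduct ?E F G P" for F G P
      using that by (rule biprod)
    show "shift_mod T ` Obj ?D = Obj ?D" by (rule shift_onto)
    show "case t of (f, g, h) \<Rightarrow> (Dom ?E f \<in> Obj ?D \<and> Cod ?E f \<in> Obj ?D \<longrightarrow> Cod ?E g \<in> Obj ?D) \<and>
      (Cod ?E f \<in> Obj ?D \<and> Cod ?E g \<in> Obj ?D \<longrightarrow> Dom ?E f \<in> Obj ?D) \<and>
      (Dom ?E f \<in> Obj ?D \<and> Cod ?E g \<in> Obj ?D \<longrightarrow> Cod ?E f \<in> Obj ?D)" if "t \<in> Tri ?E" for t
    proof -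
      obtain f g h where t: "t = (f, g, h)"
        by (rule prod_cases3)
      show ?thesis
        using that unfolding t prod.case by (rule two_of_three)
    qed
    show "Tri ?D = {(f, g, h) \<in> Tri ?E. f \<in> Arr ?D \<and> g \<in> Arr ?D \<and> h \<in> Arr ?D}" by (rule Tri)
  qed (rule refl)+
qed

end
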